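(* Every $(P_2\cup P_3)$-free graph $G$ with clique number $k=\omega(G)\ge47$ satisfies $$\chi(G)\le\frac{3}{20}k^3.$$
   Context: All graphs are finite, simple and undirected. $\chi(G)$ and $\omega(G)$ denote the chromatic number and the clique number of $G$. $P_t$ is the path on $t$ vertices, and $P_2\cup P_3$ is the graph consisting of an edge and a three-vertex path with no vertices in common and no edges between them. A graph is $H$-free if it has no induced subgraph isomorphic to $H$. *)

theory Defs
  imports Complex_Main "Graph_Theory.Digraph_Component" "Graph_Theory.Digraph_Isomorphism"
begin

text \<open>
  Finite simple undirected graphs are the members of the locale \<^locale>\<open>graph\<close>: finite, loop-free
  digraphs without parallel arcs whose adjacency relation \<open>u \<rightarrow>\<^bsub>G\<^esub> v\<close> is symmetric, so that each
  undirected edge is represented by a pair of opposite arcs.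
\<close>

definition is_clique :: "('a, 'b) pre_digraph \<Rightarrow> 'a set \<Rightarrow> bool" where
  "is_clique G S \<longleftrightarrow> S \<subseteq> verts G \<and> (\<forall>u\<in>S. \<forall>v\<in>S. u \<noteq> v \<longrightarrow> u \<rightarrow>\<^bsub>G\<^esub> v)"

definition clique_number :: "('a, 'b) pre_digraph \<Rightarrow> nat" where
  "clique_number G = Max {card S | S. is_clique G S}"

definition proper_colouring :: "('a, 'b) pre_digraph \<Rightarrow> nat \<Rightarrow> ('a \<Rightarrow> nat) \<Rightarrow> bool" where
  "proper_colouring G k c \<longleftrightarrow>
     (\<forall>v\<in>verts G. c v < k) \<and>
     (\<forall>u\<in>verts G. \<forall>v\<in>verts G. u \<rightarrow>\<^bsub>G\<^esub> v \<longrightarrow> c u \<noteq> c v)"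

definition chromatic_number :: "('a, 'b) pre_digraph \<Rightarrow> nat" where
  "chromatic_number G = (LEAST k. \<exists>c. proper_colouring G k c)"

definition path_graph :: "nat \<Rightarrow> (nat, nat \<times> nat) pre_digraph" where
  "path_graph t =
     \<lparr> verts = {..<t},
       arcs = {(i, j). i < t \<and> j < t \<and> (j = Suc i \<or> i = Suc j)},
       tail = fst, head = snd \<rparr>"

definition disjoint_union ::
    "('a, 'b) pre_digraph \<Rightarrow> ('c, 'd) pre_digraph \<Rightarrow> ('a + 'c, 'b + 'd) pre_digraph" where
  "disjoint_union G H =
     \<lparr> verts = verts G <+> verts H,
       arcs = arcs G <+> arcs H,
       tail = map_sum (tail G) (tail H),
       head = map_sum (head G) (head H) \<rparr>"

definition induced_free :: "('c, 'd) pre_digraph \<Rightarrow> ('a, 'b) pre_digraph \<Rightarrow> bool" where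
  "induced_free H G \<longleftrightarrow> \<not> (\<exists>F. induced_subgraph F G \<and> digraph_iso H F)"

text \<open>
  The predicate \<^const>\<open>digraph_iso\<close> requires its first argument to be well-formed, so
  \<^const>\<open>induced_free\<close> is meaningful only for such \<open>H\<close>.
\<close>

lemma graph_path_graph: "graph (path_graph t)"
proof -
  have "finite {(i, j). i < t \<and> j < t \<and> (j = Suc i \<or> i = Suc j)}"
    by (rule finite_subset[of _ "{..<t} \<times> {..<t}"]) auto
  then show ?thesis
    unfolding path_graph_def
    by unfold_locales (auto simp: arc_to_ends_def symmetric_conv)
qed

lemma graph_disjoint_union:
  assumes "graph G" and "graph H"
  shows "graph (disjoint_union G H)"
proof -
  interpret G: graph G by fact
  interpret H: graph H by fact
  have "\<exists>e2\<in>arcs (disjoint_union G H). tail (disjoint_union G H) e = head (disjoint_union G H) e2 \<and>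
          head (disjoint_union G H) e = tail (disjoint_union G H) e2"
    if "e \<in> arcs (disjoint_union G H)" for e
  proof (cases e)
    case (Inl a)
    with that have "a \<in> arcs G"
      by (auto simp: disjoint_union_def)
    then obtain b where "b \<in> arcs G" "tail G a = head G b" "head G a = tail G b"
      using G.sym_arcs unfolding symmetric_conv by blast
    with Inl show ?thesis
      by (auto simp: disjoint_union_def intro!: bexI[of _ "Inl b"])
  next
    case (Inr a)
    with that have "a \<in> arcs H"
      by (auto simp: disjoint_union_def)
    then obtain b where "b \<in> arcs H" "tail H a = head H b" "head H a = tail H b"
      using H.sym_arcs unfolding symmetric_conv by blast
    with Inr show ?thesis
      by (auto simp: disjoint_union_def intro!: bexI[of _ "Inr b"])
  qed
  then have "symmetric (disjoint_union G H)"
    unfolding symmetric_conv by blast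
  then show ?thesis
    by unfold_locales
      (auto simp: disjoint_union_def arc_to_ends_def G.no_loops H.no_loops
         intro: G.no_multi_arcs H.no_multi_arcs)
qed

lemma is_clique_card_le_clique_number:
  assumes "graph G" and "is_clique G S"
  shows "card S \<le> clique_number G"
proof -
  interpret graph G by fact
  have "{card S | S. is_clique G S} \<subseteq> card ` Pow (verts G)"
    by (auto simp: is_clique_def)
  then have "finite {card S | S. is_clique G S}"
    by (rule finite_subset) simp
  then show ?thesis
    unfolding clique_number_def using assms(2) by (auto intro!: Max_ge)
qed

lemma clique_number_attained:
  assumes "graph G"
  obtains S where "is_clique G S" and "card S = clique_number G"
proof -
  interpret graph G by fact
  have "{card S | S. is_clique G S} \<subseteq> card ` Pow (verts G)"
    by (auto simp: is_clique_def)
  then have "finite {card S | S. is_clique G S}"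
    by (rule finite_subset) simp
  moreover have "is_clique G {}"
    by (simp add: is_clique_def)
  ultimately have "clique_number G \<in> {card S | S. is_clique G S}"
    unfolding clique_number_def by (intro Max_in) auto
  with that show thesis
    by auto
qed

lemma chromatic_number_attained:
  assumes "graph G"
  obtains c where "proper_colouring G (chromatic_number G) c"
proof -
  interpret graph G by fact
  obtain c :: "'a \<Rightarrow> nat" where c: "bij_betw c (verts G) {0..<card (verts G)}"
    using ex_bij_betw_finite_nat[OF finite_verts] by blast
  have "c v < card (verts G)" if "v \<in> verts G" for v
    using bij_betwE[OF c] that by auto
  moreover have "c u \<noteq> c v" if "u \<in> verts G" "v \<in> verts G" "u \<rightarrow>\<^bsub>G\<^esub> v" for u v
  proof -
    have "u \<noteq> v"
      using adj_not_same that(3) by blast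
    then show ?thesis
      using bij_betw_imp_inj_on[OF c] that by (auto dest: inj_onD)
  qed
  ultimately have "proper_colouring G (card (verts G)) c"
    unfolding proper_colouring_def by blast
  then have "\<exists>k c. proper_colouring G k c"
    by blast
  then have "\<exists>c. proper_colouring G (chromatic_number G) c"
    unfolding chromatic_number_def by (rule LeastI_ex)
  with that show thesis
    by blast
qed

end

theory Submission
  imports Defs
begin

text \<open>
  Let \<open>v 0\<close>, ..., \<open>v (k - 1)\<close> be a maximum clique. Every vertex has a non-neighbour in it, which
  may be the vertex itself. The vertices with exactly one non-neighbour \<open>v i\<close> form an independent set, and those whose first two
  non-neighbours are \<open>v i\<close> and \<open>v j\<close>, with \<open>i < j\<close>, form a disjoint union \<open>two_miss i j\<close> of cliques,
  since an induced path on three vertices would be forbidden together with the edge \<open>v i v j\<close>. These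
  cliques have at most \<open>M = k - j + 1\<close> vertices.
  Colouring all these sets separately needs about \<open>k ^ 3 / 6\<close> colours. To reach \<open>3 / 20 * k ^ 3\<close>, the sets
  with the same \<open>j\<close> are grouped into pairs \<open>H\<close>, \<open>H'\<close>, and about \<open>3 / 2 * M\<close> instead of \<open>2 * M\<close> colours
  are spent on a pair. Let \<open>P\<close>, \<open>Q\<close> and \<open>P'\<close>, \<open>Q'\<close> be the two largest components of \<open>H\<close> and \<open>H'\<close>.

  If the four components have less than \<open>3 * M + 6\<close> vertices in total, then the vertices that \<open>P\<close> and
  \<open>P'\<close> have in excess of \<open>Q\<close> and \<open>Q'\<close> are set aside, and the remaining ones need \<open>card Q + card Q'\<close>
  colours. The vertices set aside in all pairs together need only half as many colours as there
  are vertices, up to \<open>k / 2\<close>: remove disjoint non-adjacent pairs until a clique is left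
  (\<open>colourable_half\<close>). So the pair accounts for half of the total number of vertices in the
  four components.

  Otherwise all four components are large. A vertex of \<open>H'\<close> with two non-neighbours in one component
  of \<open>H\<close> has no neighbours in \<open>H\<close> at all (\<open>adj_edge\<close>), there is at most one such vertex
  (\<open>far_unique\<close>), and the same holds with \<open>H\<close> and \<open>H'\<close> exchanged; the case that no edge joins \<open>H\<close>
  to \<open>H'\<close> is easy. Up to these exceptions, which lie outside the large components, non-adjacency
  between components of \<open>H\<close> and of \<open>H'\<close> is a matching. As the clique number of \<open>H \<union> H'\<close> is at most
  \<open>M + 1\<close>, the matchings between large components are large, and the small components of \<open>H\<close> turn out
  to be complete to \<open>P'\<close> and \<open>Q'\<close> (\<open>small_complete\<close>), hence too small to matter. The matchings let
  vertices of \<open>P\<close>, \<open>Q\<close> and one of \<open>P'\<close>, \<open>Q'\<close> share colours. Following non-adjacency from \<open>Q\<close> through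
  \<open>P'\<close>, \<open>P\<close>, \<open>Q'\<close> back to \<open>Q\<close> gives a partial permutation of the labels, and the labels can be cut into
  two halves that it respects up to one element (\<open>cut_exists\<close>). One half is shared with \<open>P'\<close>, the other
  half with \<open>Q'\<close> (\<open>colourable_couple\<close>).

  Summing up, twice the chromatic number is at most \<open>3 * k\<close> plus the sum of
  \<open>layer_cost j (k - j + 1)\<close> over \<open>j < k\<close>, which is at most \<open>3 / 10 * k ^ 3\<close> for \<open>k \<ge> 47\<close>.
\<close>

section \<open>Cliques and colourings of an adjacency relation\<close>

lemma obtain_max:
  fixes f :: "'a \<Rightarrow> nat"
  assumes "finite S" "S \<noteq> {}"
  obtains x where "x \<in> S" "\<And>y. y \<in> S \<Longrightarrow> f y \<le> f x"
proof -
  have "Max (f ` S) \<in> f ` S"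
    using assms by simp
  then obtain x where "x \<in> S" "f x = Max (f ` S)"
    by auto
  then show thesis
    using that assms by simp
qed

text \<open>
  The combinatorial part concerns a symmetric irreflexive relation on a type. Vertex sets are
  explicit arguments, so a set of vertices stands for the subgraph that it induces.
\<close>

locale adjacency =
  fixes adj :: "'a \<Rightarrow> 'a \<Rightarrow> bool"
  assumes adj_sym: "adj u v \<Longrightarrow> adj v u"
    and adj_irrefl: "\<not> adj u u"
begin

definition colourable :: "'a set \<Rightarrow> nat \<Rightarrow> bool" where
  "colourable A n \<longleftrightarrow>
     (\<exists>c::'a \<Rightarrow> nat. (\<forall>v\<in>A. c v < n) \<and> (\<forall>u\<in>A. \<forall>v\<in>A. adj u v \<longrightarrow> c u \<noteq> c v))"

definition clique :: "'a set \<Rightarrow> bool" where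
  "clique S \<longleftrightarrow> (\<forall>u\<in>S. \<forall>v\<in>S. u \<noteq> v \<longrightarrow> adj u v)"

text \<open>No edge joins \<open>A\<close> to \<open>B\<close>. The sets may overlap: \<open>anticomplete A A\<close> says that \<open>A\<close> is independent.\<close>

definition anticomplete :: "'a set \<Rightarrow> 'a set \<Rightarrow> bool" where
  "anticomplete A B \<longleftrightarrow> (\<forall>a\<in>A. \<forall>b\<in>B. \<not> adj a b)"

text \<open>
  A set without an induced path on three vertices, that is, a disjoint union of cliques. The
  component of \<open>x\<close> then consists of \<open>x\<close> and its neighbours.
\<close>

definition cluster :: "'a set \<Rightarrow> bool" where
  "cluster H \<longleftrightarrow> (\<forall>x\<in>H. \<forall>y\<in>H. \<forall>z\<in>H. adj x y \<longrightarrow> adj y z \<longrightarrow> x \<noteq> z \<longrightarrow> adj x z)"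

definition component :: "'a set \<Rightarrow> 'a \<Rightarrow> 'a set" where
  "component H x = {y \<in> H. y = x \<or> adj x y}"

lemma adj_commute: "adj u v \<longleftrightarrow> adj v u"
  using adj_sym by blast

lemma anticompleteD: "anticomplete A B \<Longrightarrow> a \<in> A \<Longrightarrow> b \<in> B \<Longrightarrow> \<not> adj a b \<and> \<not> adj b a"
  unfolding anticomplete_def using adj_sym by blast

lemma clique_subset: "clique S \<Longrightarrow> T \<subseteq> S \<Longrightarrow> clique T"
  unfolding clique_def by blast

lemma clique_empty: "clique {}"
  unfolding clique_def by blast

lemma anticomplete_empty: "anticomplete {} A" "anticomplete A {}"
  unfolding anticomplete_def by blast+

lemma cliqueD: "clique S \<Longrightarrow> u \<in> S \<Longrightarrow> v \<in> S \<Longrightarrow> u \<noteq> v \<Longrightarrow> adj u v"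
  unfolding clique_def by blast

lemma clique_Un:
  "clique A \<Longrightarrow> clique B \<Longrightarrow> (\<And>a b. a \<in> A \<Longrightarrow> b \<in> B \<Longrightarrow> adj a b) \<Longrightarrow> clique (A \<union> B)"
  unfolding clique_def using adj_sym by blast

lemma colourableI:
  assumes "\<And>v. v \<in> A \<Longrightarrow> c v < n"
    and "\<And>u v. u \<in> A \<Longrightarrow> v \<in> A \<Longrightarrow> adj u v \<Longrightarrow> c u \<noteq> c v"
  shows "colourable A n"
  unfolding colourable_def using assms by (intro exI[of _ c]) simp

lemma colourable_mono: "colourable A n \<Longrightarrow> B \<subseteq> A \<Longrightarrow> n \<le> m \<Longrightarrow> colourable B m"
  unfolding colourable_def by (elim exE, rule exI) (auto intro: less_le_trans)

lemma colourable_Un: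
  assumes "colourable A n" "colourable B m"
  shows "colourable (A \<union> B) (n + m)"
proof -
  obtain c where c: "\<forall>v\<in>A. c v < n" "\<forall>u\<in>A. \<forall>v\<in>A. adj u v \<longrightarrow> c u \<noteq> c v"
    using assms(1) unfolding colourable_def by blast
  obtain d where d: "\<forall>v\<in>B. d v < m" "\<forall>u\<in>B. \<forall>v\<in>B. adj u v \<longrightarrow> d u \<noteq> d v"
    using assms(2) unfolding colourable_def by blast
  let ?e = "\<lambda>v. if v \<in> A then c v else n + d v"
  have "?e v < n + m" if "v \<in> A \<union> B" for v
    using c(1) d(1) that by (auto simp: trans_less_add1)
  moreover have "?e u \<noteq> ?e v" if "u \<in> A \<union> B" "v \<in> A \<union> B" "adj u v" for u v
  proof (cases "u \<in> A"; cases "v \<in> A")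
    assume "u \<in> A" "v \<in> A"
    then have "c u \<noteq> c v" using c(2) that(3) by blast
    with \<open>u \<in> A\<close> \<open>v \<in> A\<close> show ?thesis by simp
  next
    assume "u \<in> A" "v \<notin> A"
    moreover have "c u < n" using c(1) \<open>u \<in> A\<close> by blast
    ultimately show ?thesis by simp
  next
    assume "u \<notin> A" "v \<in> A"
    moreover have "c v < n" using c(1) \<open>v \<in> A\<close> by blast
    ultimately show ?thesis by simp
  next
    assume "u \<notin> A" "v \<notin> A"
    then have "d u \<noteq> d v" using d(2) that by blast
    with \<open>u \<notin> A\<close> \<open>v \<notin> A\<close> show ?thesis by simp
  qed
  ultimately show ?thesis
    by (intro colourableI[of "A \<union> B" ?e])
qed

lemma colourable_empty: "colourable {} n"
  unfolding colourable_def by simp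

lemma colourable_anticomplete_self: "anticomplete A A \<Longrightarrow> colourable A 1"
  unfolding colourable_def anticomplete_def by (intro exI[of _ "\<lambda>_. 0"]) auto

text \<open>
  Non-adjacent pairs are removed greedily, each as one colour class, until a clique is left. For a
  large set with a small clique number about half as many colours as vertices suffice.
\<close>

lemma colourable_half:
  assumes "finite X" "\<And>S. S \<subseteq> X \<Longrightarrow> clique S \<Longrightarrow> card S \<le> k"
  shows "\<exists>c. colourable X c \<and> 2 * c \<le> card X + k"
  using assms
proof (induction "card X" arbitrary: X rule: less_induct)
  case less
  show ?case
  proof (cases "clique X")
    case True
    obtain c :: "'a \<Rightarrow> nat" where c: "bij_betw c X {0..<card X}"
      using ex_bij_betw_finite_nat[OF less.prems(1)] by blast
    have "colourable X (card X)"
      unfolding colourable_def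
    proof (intro exI conjI ballI impI)
      show "c v < card X" if "v \<in> X" for v
        using bij_betwE[OF c] that by auto
      show "c u \<noteq> c v" if "u \<in> X" "v \<in> X" "adj u v" for u v
        using bij_betw_imp_inj_on[OF c] that adj_irrefl by (auto dest: inj_onD)
    qed
    moreover have "card X \<le> k"
      using less.prems(2)[OF subset_refl True] .
    ultimately show ?thesis
      by (intro exI[of _ "card X"]) auto
  next
    case False
    then obtain u w where uw: "u \<in> X" "w \<in> X" "u \<noteq> w" "\<not> adj u w"
      unfolding clique_def by blast
    define Y where "Y = X - {u, w}"
    have card: "card X = card Y + 2"
    proof -
      have "card {u, w} \<le> card X"
        using uw less.prems(1) by (intro card_mono) auto
      then show ?thesis
        using uw less.prems(1) unfolding Y_def by (simp add: card_Diff_subset)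
    qed
    have "\<exists>c. colourable Y c \<and> 2 * c \<le> card Y + k"
      using less.prems card by (intro less.hyps) (auto simp: Y_def)
    then obtain c where c: "colourable Y c" "2 * c \<le> card Y + k"
      by blast
    have "colourable {u, w} 1"
      using uw adj_sym adj_irrefl
      by (intro colourable_anticomplete_self) (auto simp: anticomplete_def)
    with c(1) have "colourable (Y \<union> {u, w}) (c + 1)"
      by (rule colourable_Un)
    moreover have "Y \<union> {u, w} = X"
      using uw by (auto simp: Y_def)
    ultimately show ?thesis
      using c(2) card by (intro exI[of _ "c + 1"]) auto
  qed
qed

section \<open>Disjoint unions of cliques\<close>

lemma clusterD: "cluster H \<Longrightarrow> x \<in> H \<Longrightarrow> y \<in> H \<Longrightarrow> z \<in> H \<Longrightarrow> adj x y \<Longrightarrow> adj y z \<Longrightarrow> x \<noteq> z \<Longrightarrow> adj x z"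
  unfolding cluster_def by blast

lemma cluster_subset: "cluster H \<Longrightarrow> G \<subseteq> H \<Longrightarrow> cluster G"
  unfolding cluster_def by blast

lemma component_eq:
  assumes "cluster H" "x \<in> H" "y \<in> H" "adj x y"
  shows "component H x = component H y"
  using clusterD[OF assms(1)] assms(2-4) adj_sym unfolding component_def by blast

lemma clique_component: "cluster H \<Longrightarrow> x \<in> H \<Longrightarrow> clique (component H x)"
  unfolding clique_def component_def using clusterD adj_sym by blast

lemma component_separated: "cluster H \<Longrightarrow> x \<in> H \<Longrightarrow> anticomplete (component H x) (H - component H x)"
  unfolding component_def anticomplete_def using clusterD by blast

lemma colourable_cluster:
  assumes "finite H" "cluster H" "\<And>x. x \<in> H \<Longrightarrow> card (component H x) \<le> n"
  shows "colourable H n"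
proof -
  have "\<exists>f::'a \<Rightarrow> nat. inj_on f Q \<and> f ` Q \<subseteq> {..<n}" if "Q \<in> component H ` H" for Q
  proof -
    have "finite Q" "card Q \<le> card {..<n}"
      using that assms by (auto simp: component_def)
    then show ?thesis
      using inj_on_iff_card_le[of Q "{..<n}"] by simp
  qed
  then obtain f :: "'a set \<Rightarrow> 'a \<Rightarrow> nat"
    where f: "\<And>Q. Q \<in> component H ` H \<Longrightarrow> inj_on (f Q) Q \<and> f Q ` Q \<subseteq> {..<n}"
    by metis
  show ?thesis
    unfolding colourable_def
  proof (intro exI conjI ballI impI)
    show "f (component H v) v < n" if "v \<in> H" for v
      using f[of "component H v"] that by (auto simp: component_def)
    show "f (component H u) u \<noteq> f (component H v) v" if "u \<in> H" "v \<in> H" "adj u v" for u v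
    proof -
      have "component H u = component H v"
        using component_eq assms(2) that by blast
      moreover have "u \<in> component H u" "v \<in> component H u" "u \<noteq> v"
        using that adj_irrefl by (auto simp: component_def)
      ultimately show ?thesis
        using f[of "component H u"] that by (auto dest: inj_onD)
    qed
  qed
qed

text \<open>
  \<open>P\<close> and \<open>Q\<close> are a largest and a second largest component of \<open>H\<close>, with the empty set in place
  of a missing component.
\<close>

definition top_two :: "'a set \<Rightarrow> 'a set \<Rightarrow> 'a set \<Rightarrow> bool" where
  "top_two H P Q \<longleftrightarrow> P \<subseteq> H \<and> Q \<subseteq> H \<and> P \<inter> Q = {} \<and> clique P \<and> clique Q \<and>
     anticomplete P (H - P) \<and> anticomplete Q (H - Q) \<and> card Q \<le> card P \<and>
     (\<forall>x\<in>H - P. card (component H x) \<le> card Q)"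

lemma top_two_exists:
  assumes "finite H" "cluster H"
  shows "\<exists>P Q. top_two H P Q"
proof (cases "H = {}")
  case True
  then show ?thesis
    by (auto simp: top_two_def clique_def anticomplete_def)
next
  case False
  obtain x where x: "x \<in> H" "\<And>y. y \<in> H \<Longrightarrow> card (component H y) \<le> card (component H x)"
    by (rule obtain_max[OF assms(1) False, of "\<lambda>x. card (component H x)"]) (rule that)
  define P where "P = component H x"
  show ?thesis
  proof (cases "H - P = {}")
    case True
    have "P \<subseteq> H" "clique P" "anticomplete P (H - P)"
      using clique_component[OF assms(2) x(1)] component_separated[OF assms(2) x(1)]
      unfolding P_def by (auto simp: component_def)
    with True have "top_two H P {}"
      unfolding top_two_def by (auto simp: clique_empty anticomplete_empty)
    then show ?thesis by blast
  next
    case False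
    obtain y where y: "y \<in> H - P" "\<And>z. z \<in> H - P \<Longrightarrow> card (component H z) \<le> card (component H y)"
      by (rule obtain_max[OF finite_Diff[OF assms(1)] False, of "\<lambda>x. card (component H x)"]) (rule that)
    have "P \<inter> component H y = {}"
    proof -
      have "\<not> adj y z" if "z \<in> P" for z
        using anticompleteD[OF component_separated[OF assms(2) x(1)]] y(1) that unfolding P_def
        by blast
      then show ?thesis using y(1) by (auto simp: component_def)
    qed
    moreover have "P \<subseteq> H" "component H y \<subseteq> H" "clique P" "clique (component H y)"
      "anticomplete P (H - P)" "anticomplete (component H y) (H - component H y)"
      "card (component H y) \<le> card P"
      using x y clique_component[OF assms(2)] component_separated[OF assms(2)]
      unfolding P_def by (auto simp: component_def)
    ultimately have "top_two H P (component H y)"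
      unfolding top_two_def using y(2) by blast
    then show ?thesis by blast
  qed
qed

text \<open>Setting aside \<open>card P - card Q\<close> vertices of \<open>P\<close> makes \<open>Q\<close> a largest component.\<close>

lemma top_two_trim:
  assumes "finite H" "cluster H" "top_two H P Q"
  shows "\<exists>X\<subseteq>H. colourable (H - X) (card Q) \<and> card X = card P - card Q"
proof -
  note t = assms(3)[unfolded top_two_def]
  have finP: "finite P"
    using t assms(1) finite_subset by blast
  obtain X where X: "X \<subseteq> P" "card X = card P - card Q"
    by (meson diff_le_self obtain_subset_with_card_n)
  have "colourable (H - X) (card Q)"
  proof (rule colourable_cluster)
    show "finite (H - X)" using assms(1) by blast
    show "cluster (H - X)" using assms(2) cluster_subset by blast
    fix x assume x: "x \<in> H - X"
    show "card (component (H - X) x) \<le> card Q"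
    proof (cases "x \<in> P")
      case True
      then have "component (H - X) x \<subseteq> P - X"
        using t x by (auto simp: component_def dest: anticompleteD)
      then have "card (component (H - X) x) \<le> card (P - X)"
        using finP by (intro card_mono) auto
      also have "\<dots> = card Q"
        using X finP t by (simp add: card_Diff_subset finite_subset)
      finally show ?thesis .
    next
      case False
      have "card (component (H - X) x) \<le> card (component H x)"
        using assms(1) by (intro card_mono) (auto simp: component_def)
      also have "\<dots> \<le> card Q"
        using t x False by blast
      finally show ?thesis .
    qed
  qed
  then show ?thesis
    using X t by (intro exI[of _ X]) auto
qed

section \<open>Colouring two matched pairs of cliques\<close>

text \<open>
  Two cliques in which non-adjacency between \<open>A\<close> and \<open>B\<close> is a matching: every vertex of \<open>B\<close>
  with a non-neighbour in \<open>A\<close> inherits its label, and the bound on the clique number leaves enough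
  unused labels for the others.
\<close>

lemma label_exists:
  fixes f :: "'a \<Rightarrow> nat"
  assumes fin: "finite A" "finite B" and disj: "A \<inter> B = {}" and cl: "clique A" "clique B"
    and f: "inj_on f A" "f ` A \<subseteq> {..<m}"
    and one_B: "\<And>a b b'. a \<in> A \<Longrightarrow> b \<in> B \<Longrightarrow> b' \<in> B \<Longrightarrow> \<not> adj a b \<Longrightarrow> \<not> adj a b' \<Longrightarrow> b = b'"
    and one_A: "\<And>a a' b. a \<in> A \<Longrightarrow> a' \<in> A \<Longrightarrow> b \<in> B \<Longrightarrow> \<not> adj a b \<Longrightarrow> \<not> adj a' b \<Longrightarrow> a = a'"
    and bound: "\<And>S. S \<subseteq> A \<union> B \<Longrightarrow> clique S \<Longrightarrow> card S \<le> m"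
  shows "\<exists>g::'a \<Rightarrow> nat. inj_on g B \<and> g ` B \<subseteq> {..<m} \<and> (\<forall>a\<in>A. \<forall>b\<in>B. f a = g b \<longrightarrow> \<not> adj a b)"
proof -
  define D where "D = {b \<in> B. \<exists>a\<in>A. \<not> adj a b}"
  define s where "s b = (SOME a. a \<in> A \<and> \<not> adj a b)" for b
  have s: "s b \<in> A" "\<not> adj (s b) b" if "b \<in> D" for b
    using someI_ex[of "\<lambda>a. a \<in> A \<and> \<not> adj a b"] that by (auto simp: D_def s_def)
  have s_inj: "inj_on s D"
  proof (rule inj_onI)
    fix b b' assume b: "b \<in> D" "b' \<in> D" "s b = s b'"
    then have "b \<in> B" "b' \<in> B" by (auto simp: D_def)
    then show "b = b'"
      using one_B[of "s b" b b'] s b by metis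
  qed
  have "clique (A \<union> (B - D))"
    using clique_subset[OF cl(2), of "B - D"] by (intro clique_Un cl(1)) (auto simp: D_def)
  then have "card (A \<union> (B - D)) \<le> m"
    by (intro bound) blast
  moreover have "card (A \<union> (B - D)) = card A + card (B - D)"
    using fin disj by (intro card_Un_disjoint) auto
  moreover have "card ({..<m} - f ` A) = m - card A"
    using card_Diff_subset[OF finite_imageI[OF fin(1)] f(2)] card_image[OF f(1)] by simp
  ultimately have "card (B - D) \<le> card ({..<m} - f ` A)"
    by linarith
  then obtain h where h: "inj_on h (B - D)" "h ` (B - D) \<subseteq> {..<m} - f ` A"
    using inj_on_iff_card_le[of "B - D" "{..<m} - f ` A"] fin(2) by blast
  define g where "g b = (if b \<in> D then f (s b) else h b)" for b
  have "inj_on g B"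
  proof (rule inj_onI)
    fix b b' assume b: "b \<in> B" "b' \<in> B" "g b = g b'"
    show "b = b'"
    proof (cases "b \<in> D"; cases "b' \<in> D")
      assume "b \<in> D" "b' \<in> D"
      then have "s b = s b'"
        using b s(1) inj_onD[OF f(1)] by (simp add: g_def)
      then show ?thesis
        using inj_onD[OF s_inj] \<open>b \<in> D\<close> \<open>b' \<in> D\<close> by blast
    next
      assume "b \<in> D" "b' \<notin> D"
      then show ?thesis
        using b s h(2) by (auto simp: g_def)
    next
      assume "b \<notin> D" "b' \<in> D"
      then have "h b \<in> f ` A"
        using b s by (auto simp: g_def)
      then show ?thesis
        using b h(2) \<open>b \<notin> D\<close> by auto
    next
      assume "b \<notin> D" "b' \<notin> D"
      then show ?thesis
        using b h(1) by (auto simp: g_def dest: inj_onD)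
    qed
  qed
  moreover have "g ` B \<subseteq> {..<m}"
    using f(2) s h(2) by (auto simp: g_def)
  moreover have "\<not> adj a b" if "a \<in> A" "b \<in> B" "f a = g b" for a b
  proof (cases "b \<in> D")
    case True
    then have "a = s b"
      using that f(1) s by (auto simp: g_def dest: inj_onD)
    then show ?thesis using s True by blast
  next
    case False
    then show ?thesis
      using that h(2) by (auto simp: g_def)
  qed
  ultimately show ?thesis by blast
qed

end

text \<open>
  Going from \<open>f y\<close> to \<open>f' y\<close> defines a partial injection of labels. Adding one label at a time, each
  time the label \<open>f y\<close> of the only \<open>y\<close> that enters \<open>B\<close> from outside, if there is one, keeps the
  number of such \<open>y\<close> at most one.
\<close>

lemma cut_exists:
  fixes f f' :: "'a \<Rightarrow> nat"
  assumes "finite Q" "inj_on f Q" "inj_on f' Q" "b \<le> m"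
  shows "\<exists>B\<subseteq>{..<m}. card B = b \<and> card {y \<in> Q. f y \<in> {..<m} - B \<and> f' y \<in> B} \<le> 1"
  using assms(4)
proof (induction b)
  case 0
  show ?case by (intro exI[of _ "{}"]) auto
next
  case (Suc b)
  then obtain B where B: "B \<subseteq> {..<m}" "card B = b"
    "card {y \<in> Q. f y \<in> {..<m} - B \<and> f' y \<in> B} \<le> 1"
    by auto
  have finB: "finite B"
    using B(1) finite_subset by blast
  have one: "card {y \<in> Q. f' y = l} \<le> 1" for l
    using assms(3) by (intro card_le_Suc0_iff_eq[THEN iffD2, unfolded One_nat_def[symmetric]])
      (auto simp: assms(1) dest: inj_onD)
  obtain l where l: "l \<in> {..<m} - B"
    "{y \<in> Q. f y \<in> {..<m} - B \<and> f' y \<in> B} \<subseteq> {y \<in> Q. f y = l}"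
  proof (cases "{y \<in> Q. f y \<in> {..<m} - B \<and> f' y \<in> B} = {}")
    case True
    have "card B < card {..<m}"
      using B(2) Suc.prems by simp
    then have "{..<m} - B \<noteq> {}"
      using finB by (metis B(1) Diff_eq_empty_iff less_irrefl subset_antisym)
    then show ?thesis
      using that True by auto
  next
    case False
    then have "card {y \<in> Q. f y \<in> {..<m} - B \<and> f' y \<in> B} = 1"
      using B(3) assms(1) by (metis (no_types, lifting) One_nat_def card_0_eq finite_subset le_SucE
          le_zero_eq mem_Collect_eq subsetI)
    then obtain y where "{y \<in> Q. f y \<in> {..<m} - B \<and> f' y \<in> B} = {y}"
      using card_1_singletonE by blast
    then show ?thesis
      using that[of "f y"] by auto
  qed
  have "{y \<in> Q. f y \<in> {..<m} - insert l B \<and> f' y \<in> insert l B} \<subseteq> {y \<in> Q. f' y = l}"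
    using l(2) by blast
  then have "card {y \<in> Q. f y \<in> {..<m} - insert l B \<and> f' y \<in> insert l B} \<le> 1"
    using order.trans[OF card_mono one[of l]] assms(1) by simp
  then show ?case
    using B l finB by (intro exI[of _ "insert l B"]) auto
qed

context adjacency
begin

text \<open>
  Two disjoint cliques between which non-adjacency is a matching, with clique number at most \<open>m\<close>
  in their union.
\<close>

definition matched :: "nat \<Rightarrow> 'a set \<Rightarrow> 'a set \<Rightarrow> bool" where
  "matched m A B \<longleftrightarrow> finite A \<and> finite B \<and> A \<inter> B = {} \<and> clique A \<and> clique B \<and>
     (\<forall>a\<in>A. \<forall>b\<in>B. \<forall>b'\<in>B. \<not> adj a b \<longrightarrow> \<not> adj a b' \<longrightarrow> b = b') \<and>
     (\<forall>a\<in>A. \<forall>a'\<in>A. \<forall>b\<in>B. \<not> adj a b \<longrightarrow> \<not> adj a' b \<longrightarrow> a = a') \<and>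
     (\<forall>S. S \<subseteq> A \<union> B \<longrightarrow> clique S \<longrightarrow> card S \<le> m)"

lemma matched_commute: "matched m A B \<longleftrightarrow> matched m B A"
  unfolding matched_def by (auto simp: Un_commute Int_commute adj_commute)

lemma matched_label:
  fixes f :: "'a \<Rightarrow> nat"
  assumes "matched m A B" "inj_on f A" "f ` A \<subseteq> {..<m}"
  obtains g :: "'a \<Rightarrow> nat"
  where "inj_on g B" "g ` B \<subseteq> {..<m}" "\<And>a b. a \<in> A \<Longrightarrow> b \<in> B \<Longrightarrow> f a = g b \<Longrightarrow> \<not> adj a b"
proof -
  have "\<exists>g::'a \<Rightarrow> nat. inj_on g B \<and> g ` B \<subseteq> {..<m} \<and> (\<forall>a\<in>A. \<forall>b\<in>B. f a = g b \<longrightarrow> \<not> adj a b)"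
    using assms(1) unfolding matched_def by (intro label_exists assms(2,3)) metis+
  then show thesis using that by blast
qed

lemma colourable_join:
  assumes "A \<inter> B = {}"
    and A: "\<And>v. v \<in> A \<Longrightarrow> c v < n" "\<And>u v. u \<in> A \<Longrightarrow> v \<in> A \<Longrightarrow> adj u v \<Longrightarrow> c u \<noteq> c v"
    and B: "\<And>v. v \<in> B \<Longrightarrow> d v < n" "\<And>u v. u \<in> B \<Longrightarrow> v \<in> B \<Longrightarrow> adj u v \<Longrightarrow> d u \<noteq> d v"
    and AB: "\<And>a b. a \<in> A \<Longrightarrow> b \<in> B \<Longrightarrow> c a = d b \<Longrightarrow> \<not> adj a b"
  shows "colourable (A \<union> B) n"
proof (rule colourableI[of _ "\<lambda>v. if v \<in> A then c v else d v"])
  show "(if v \<in> A then c v else d v) < n" if "v \<in> A \<union> B" for v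
    using that A(1) B(1) by auto
  show "(if u \<in> A then c u else d u) \<noteq> (if v \<in> A then c v else d v)"
    if uv: "u \<in> A \<union> B" "v \<in> A \<union> B" "adj u v" for u v
  proof (cases "u \<in> A"; cases "v \<in> A")
    assume "u \<in> A" "v \<in> A"
    with A(2)[of u v] uv(3) show ?thesis by simp
  next
    assume "u \<in> A" "v \<notin> A"
    with AB[of u v] uv show ?thesis by auto
  next
    assume "u \<notin> A" "v \<in> A"
    with AB[of v u] uv adj_sym[OF uv(3)] show ?thesis by auto
  next
    assume "u \<notin> A" "v \<notin> A"
    with B(2)[of u v] uv show ?thesis by auto
  qed
qed

lemma injection_into:
  assumes "finite A" "finite B" "card A \<le> card B"
  obtains f where "inj_on f A" "f ` A \<subseteq> B"
  using inj_on_iff_card_le[OF assms(1,2)] assms(3) by blast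

text \<open>
  Here \<open>P\<close>, \<open>Q\<close> are the large components of one cluster graph, \<open>P'\<close>, \<open>Q'\<close> those of another, and
  \<open>R\<close>, \<open>R'\<close> collect the small components. Labels below \<open>m\<close> are chosen along \<open>P\<close> to \<open>P'\<close> to \<open>Q\<close> and along
  \<open>P\<close> to \<open>Q'\<close> to \<open>Q\<close>, so that equal labels in consecutive sets of a chain mean non-adjacency and \<open>Q\<close>
  carries two labellings. A set \<open>B\<close> of half of the labels is offered to \<open>P'\<close>, its complement to
  \<open>Q'\<close>, and what does not fit takes one of \<open>m - m div 2\<close> extra colours. A vertex of \<open>Q\<close> can use its
  first label if that lies in \<open>B\<close> and its second one if that lies outside \<open>B\<close>; \<open>T\<close> holds the at
  most one vertex that can do neither. The set \<open>R\<close> uses colours absent from \<open>P'\<close>, \<open>Q'\<close> and \<open>R'\<close>.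
\<close>

lemma colourable_couple:
  assumes M: "matched m P P'" "matched m P Q'" "matched m Q P'" "matched m Q Q'"
    and H: "anticomplete P Q" "anticomplete P R" "anticomplete Q R"
    and H': "anticomplete P' Q'" "anticomplete P' R'" "anticomplete Q' R'"
    and disj: "P \<inter> Q = {}" "(P \<union> Q) \<inter> R = {}" "P' \<inter> Q' = {}" "(P' \<union> Q') \<inter> R' = {}"
      "(P \<union> Q \<union> R) \<inter> (P' \<union> Q' \<union> R') = {}"
    and R: "colourable R (m - card P')" and R': "colourable R' (m - card P)"
    and le: "card Q' \<le> card P'" "2 * m \<le> card P + card P' + (m - m div 2)"
  shows "\<exists>T\<subseteq>Q. card T \<le> 1 \<and>
           colourable ((P \<union> Q \<union> R) \<union> (P' \<union> Q' \<union> R') - T) (m + (m - m div 2))"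
proof -
  define e where "e = m - m div 2"
  have fin: "finite P" "finite Q" "finite P'" "finite Q'"
    using M unfolding matched_def by blast+
  have cardP: "card P \<le> m" "card P' \<le> m"
    using M(1) unfolding matched_def by blast+
  obtain f where f: "inj_on f P" "f ` P \<subseteq> {..<m}"
    using injection_into[of P "{..<m}"] fin cardP by auto
  obtain g where g: "inj_on g P'" "g ` P' \<subseteq> {..<m}"
    "\<And>x y. x \<in> P \<Longrightarrow> y \<in> P' \<Longrightarrow> f x = g y \<Longrightarrow> \<not> adj x y"
    using matched_label[OF M(1) f] by blast
  obtain h where h: "inj_on h Q'" "h ` Q' \<subseteq> {..<m}"
    "\<And>x y. x \<in> P \<Longrightarrow> y \<in> Q' \<Longrightarrow> f x = h y \<Longrightarrow> \<not> adj x y"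
    using matched_label[OF M(2) f] by blast
  obtain p where p: "inj_on p Q" "p ` Q \<subseteq> {..<m}"
    "\<And>y x. y \<in> P' \<Longrightarrow> x \<in> Q \<Longrightarrow> g y = p x \<Longrightarrow> \<not> adj y x"
    using matched_label[OF M(3)[unfolded matched_commute[of m Q]] g(1,2)] by blast
  obtain q where q: "inj_on q Q" "q ` Q \<subseteq> {..<m}"
    "\<And>y x. y \<in> Q' \<Longrightarrow> x \<in> Q \<Longrightarrow> h y = q x \<Longrightarrow> \<not> adj y x"
    using matched_label[OF M(4)[unfolded matched_commute[of m Q]] h(1,2)] by blast
  obtain B where B: "B \<subseteq> {..<m}" "card B = m div 2"
    "card {x \<in> Q. p x \<in> {..<m} - B \<and> q x \<in> B} \<le> 1"
    using cut_exists[OF fin(2) p(1) q(1), of "m div 2" m] by auto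
  define T where "T = {x \<in> Q. p x \<in> {..<m} - B \<and> q x \<in> B}"
  have finB: "finite B" "finite ({..<m} - B)" and cardB: "card ({..<m} - B) = e"
    using B(1,2) finite_subset[OF B(1)] by (auto simp: card_Diff_subset e_def)

  define P1 where "P1 = {y \<in> P'. g y \<in> B}"
  define P2 where "P2 = {y \<in> P'. g y \<notin> B}"
  define Q1 where "Q1 = {y \<in> Q'. h y \<notin> B}"
  define Q2 where "Q2 = {y \<in> Q'. h y \<in> B}"
  have fins: "finite P1" "finite P2" "finite Q1" "finite Q2"
    using fin by (auto simp: P1_def P2_def Q1_def Q2_def)
  have P12: "card P1 + card P2 = card P'"
    unfolding P1_def P2_def using fin(3) by (subst card_Un_disjoint[symmetric]) (auto intro: arg_cong[of _ _ card])
  have Q12: "card Q1 + card Q2 = card Q'"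
    unfolding Q1_def Q2_def using fin(4) by (subst card_Un_disjoint[symmetric]) (auto intro: arg_cong[of _ _ card])
  have cards: "card P1 \<le> m div 2" "card P2 \<le> e" "card Q1 \<le> e" "card Q2 \<le> m div 2"
  proof -
    have "g ` P1 \<subseteq> B" "g ` P2 \<subseteq> {..<m} - B" "h ` Q1 \<subseteq> {..<m} - B" "h ` Q2 \<subseteq> B"
      using g(2) h(2) by (auto simp: P1_def P2_def Q1_def Q2_def)
    moreover have "inj_on g P1" "inj_on g P2" "inj_on h Q1" "inj_on h Q2"
      using g(1) h(1) by (auto simp: P1_def P2_def Q1_def Q2_def inj_on_def)
    ultimately show "card P1 \<le> m div 2" "card P2 \<le> e" "card Q1 \<le> e" "card Q2 \<le> m div 2"
      using card_inj_on_le[of g P1 B] card_inj_on_le[of g P2 "{..<m} - B"]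
        card_inj_on_le[of h Q1 "{..<m} - B"] card_inj_on_le[of h Q2 B] finB cardB B(2)
      by auto
  qed
  obtain i where i: "inj_on i P2" "i ` P2 \<subseteq> {..<card P2}"
    using injection_into[of P2 "{..<card P2}"] fins by auto
  obtain j where j: "inj_on j Q2" "j ` Q2 \<subseteq> {..<card Q2}"
    using injection_into[of Q2 "{..<card Q2}"] fins by auto

  have e: "m div 2 \<le> e" "m div 2 + e = m"
    unfolding e_def by auto
  note le = cardP le[folded e_def]
  \<comment> \<open>The vertices left over in \<open>P'\<close> and \<open>Q'\<close> and all of \<open>R'\<close> use the extra colours from \<open>m\<close> to \<open>m + w - 1\<close>.\<close>
  define w where "w = max (max (card P2) (card Q2)) (m - card P)"
  have w: "w \<le> e"
    using cards le e unfolding w_def max_def by auto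
  \<comment> \<open>This set contains all colours on \<open>P'\<close>, \<open>Q'\<close> and \<open>R'\<close>.\<close>
  define W where "W = g ` P1 \<union> h ` Q1 \<union> {m..<m + w}"
  have finW: "finite W" and W: "W \<subseteq> {..<m + e}"
    using fins w g(2) h(2) by (auto simp: W_def P1_def Q1_def)
  have "card W \<le> card (g ` P1 \<union> h ` Q1) + card {m..<m + w}"
    unfolding W_def by (rule card_Un_le)
  also have "\<dots> \<le> (card (g ` P1) + card (h ` Q1)) + w"
    using card_Un_le by (intro add_mono) auto
  also have "\<dots> \<le> (card P1 + card Q1) + w"
    using fins by (intro add_mono card_image_le) auto
  finally have cardW: "card W \<le> card P1 + card Q1 + w" by simp
  have "m - card P' \<le> m + e - (card P1 + card Q1 + w)"
    using P12 Q12 cards le e unfolding w_def max_def by auto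
  then have "card {..<m - card P'} \<le> card ({..<m + e} - W)"
    using cardW finW W by (simp add: card_Diff_subset)
  then obtain k where k: "inj_on k {..<m - card P'}" "k ` {..<m - card P'} \<subseteq> {..<m + e} - W"
    using injection_into[of "{..<m - card P'}" "{..<m + e} - W"] by auto
  obtain r where r: "\<And>v. v \<in> R \<Longrightarrow> r v < m - card P'"
    "\<And>u v. u \<in> R \<Longrightarrow> v \<in> R \<Longrightarrow> adj u v \<Longrightarrow> r u \<noteq> r v"
    using R unfolding colourable_def by blast
  obtain s where s: "\<And>v. v \<in> R' \<Longrightarrow> s v < m - card P"
    "\<And>u v. u \<in> R' \<Longrightarrow> v \<in> R' \<Longrightarrow> adj u v \<Longrightarrow> s u \<noteq> s v"
    using R' unfolding colourable_def by blast

  define c where "c x = (if x \<in> P then f x else if x \<in> Q then (if p x \<in> B then p x else q x) else k (r x))" for x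
  define d where "d y = (if y \<in> P' then (if g y \<in> B then g y else m + i y)
     else if y \<in> Q' then (if h y \<in> B then m + j y else h y) else m + s y)" for y
  have cP: "c x = f x" if "x \<in> P" for x using that by (simp add: c_def)
  have cQ: "c x = (if p x \<in> B then p x else q x)" if "x \<in> Q" for x
    using that disj(1) by (auto simp: c_def)
  have cR: "c x = k (r x)" if "x \<in> R" for x
    using that disj(2) by (auto simp: c_def)
  have dP: "d x = (if g x \<in> B then g x else m + i x)" if "x \<in> P'" for x
    using that by (simp add: d_def)
  have dQ: "d x = (if h x \<in> B then m + j x else h x)" if "x \<in> Q'" for x
    using that disj(3) by (auto simp: d_def)
  have dR: "d x = m + s x" if "x \<in> R'" for x
    using that disj(4) by (auto simp: d_def)
  have fm: "f x < m" if "x \<in> P" for x using f(2) that by auto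
  have gm: "g x < m" if "x \<in> P'" for x using g(2) that by auto
  have hm: "h x < m" if "x \<in> Q'" for x using h(2) that by auto
  have pm: "p x < m" "q x < m" if "x \<in> Q" for x using p(2) q(2) that by auto
  have im: "i y < w" if "y \<in> P'" "g y \<notin> B" for y
    using that i(2) by (force simp: P2_def w_def)
  have jm: "j y < w" if "y \<in> Q'" "h y \<in> B" for y
    using that j(2) by (force simp: Q2_def w_def)
  have cRW: "c x \<notin> W" "c x < m + e" if "x \<in> R" for x
    using k(2) r(1)[OF that] by (auto simp: cR[OF that])
  have dW: "d y \<in> W" if "y \<in> P' \<union> Q' \<union> R'" for y
  proof -
    consider "y \<in> P'" | "y \<in> Q'" | "y \<in> R'" using \<open>y \<in> P' \<union> Q' \<union> R'\<close> by blast
    then show ?thesis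
    proof cases
      case 1
      then show ?thesis
        using im[OF 1] by (auto simp: dP W_def P1_def)
    next
      case 2
      then show ?thesis
        using jm[OF 2] by (auto simp: dQ W_def Q1_def)
    next
      case 3
      then show ?thesis
        using s(1)[OF 3] by (auto simp: dR W_def w_def)
    qed
  qed
  have cPQ: "c x < m" if "x \<in> P \<union> Q" for x
    using that fm pm by (auto simp: cP cQ)

  have "colourable (((P \<union> Q \<union> R) - T) \<union> (P' \<union> Q' \<union> R')) (m + e)"
  proof (rule colourable_join[of _ _ c _ d])
    show "((P \<union> Q \<union> R) - T) \<inter> (P' \<union> Q' \<union> R') = {}"
      using disj(5) by blast
    show "c v < m + e" if "v \<in> (P \<union> Q \<union> R) - T" for v
      using that cPQ[of v] cRW(2)[of v] by (auto intro: trans_less_add1)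
    show "d v < m + e" if "v \<in> P' \<union> Q' \<union> R'" for v
      using dW[OF that] W by auto
    show "c u \<noteq> c v" if uv: "u \<in> (P \<union> Q \<union> R) - T" "v \<in> (P \<union> Q \<union> R) - T" "adj u v" for u v
    proof -
      have ne: "u \<noteq> v" using uv(3) adj_irrefl by blast
      consider "u \<in> P" "v \<in> P" | "u \<in> Q" "v \<in> Q" "u \<notin> T" "v \<notin> T" | "u \<in> R" "v \<in> R"
        using uv H anticompleteD by (metis DiffE Un_iff)
      then show ?thesis
      proof cases
        case 1
        then show ?thesis using inj_onD[OF f(1)] ne by (auto simp: cP)
      next
        case 2
        have "q u \<notin> B" if "p u \<notin> B" using 2(1,3) pm that by (auto simp: T_def)
        moreover have "q v \<notin> B" if "p v \<notin> B" using 2(2,4) pm that by (auto simp: T_def)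
        ultimately show ?thesis
          using inj_onD[OF p(1), of u v] inj_onD[OF q(1), of u v] 2 ne by (auto simp: cQ)
      next
        case 3
        then show ?thesis
          using inj_onD[OF k(1), of "r u" "r v"] r[of u] r[of v] r(2)[OF 3 uv(3)]
          by (auto simp: cR)
      qed
    qed
    show "d u \<noteq> d v" if uv: "u \<in> P' \<union> Q' \<union> R'" "v \<in> P' \<union> Q' \<union> R'" "adj u v" for u v
    proof -
      have ne: "u \<noteq> v" using uv(3) adj_irrefl by blast
      consider "u \<in> P'" "v \<in> P'" | "u \<in> Q'" "v \<in> Q'" | "u \<in> R'" "v \<in> R'"
        using uv H' anticompleteD by (metis Un_iff)
      then show ?thesis
      proof cases
        case 1
        then show ?thesis
          using inj_onD[OF g(1), of u v] inj_onD[OF i(1), of u v] ne gm[of u] gm[of v]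
          by (auto simp: dP P2_def)
      next
        case 2
        then show ?thesis
          using inj_onD[OF h(1), of u v] inj_onD[OF j(1), of u v] ne hm[of u] hm[of v]
          by (auto simp: dQ Q2_def)
      next
        case 3
        then show ?thesis using s(2)[OF 3 uv(3)] by (simp add: dR)
      qed
    qed
    show "\<not> adj a b" if ab: "a \<in> (P \<union> Q \<union> R) - T" "b \<in> P' \<union> Q' \<union> R'" "c a = d b" for a b
    proof -
      consider "a \<in> R" | "a \<in> P \<union> Q" "b \<in> R'" | "a \<in> P" "b \<in> P'" | "a \<in> P" "b \<in> Q'"
        | "a \<in> Q" "a \<notin> T" "b \<in> P'" | "a \<in> Q" "a \<notin> T" "b \<in> Q'"
        using ab(1,2) by blast
      then show ?thesis
      proof cases
        case 1
        then show ?thesis using cRW(1)[OF 1] dW[OF ab(2)] ab(3) by simp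
      next
        case 2
        then show ?thesis using cPQ[OF 2(1)] ab(3) by (simp add: dR)
      next
        case 3
        then have "f a = g b" using ab(3) fm[of a] by (auto simp: cP dP split: if_splits)
        then show ?thesis using g(3) 3 by blast
      next
        case 4
        then have "f a = h b" using ab(3) fm[of a] by (auto simp: cP dQ split: if_splits)
        then show ?thesis using h(3) 4 by blast
      next
        case 5
        have "q a \<notin> B" if "p a \<notin> B" using 5(1,2) pm that by (auto simp: T_def)
        then have "g b = p a"
          using ab(3) 5 pm[of a] by (auto simp: cQ dP split: if_splits)
        then show ?thesis using p(3) 5 adj_sym by blast
      next
        case 6
        then have "h b = q a"
          using ab(3) 6 pm[of a] by (auto simp: cQ dQ split: if_splits)
        then show ?thesis using q(3) 6 adj_sym by blast
      qed
    qed
  qed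
  moreover have "((P \<union> Q \<union> R) - T) \<union> (P' \<union> Q' \<union> R') = (P \<union> Q \<union> R) \<union> (P' \<union> Q' \<union> R') - T"
    using disj(5) by (auto simp: T_def)
  moreover have "T \<subseteq> Q" "card T \<le> 1"
    using B(3) by (auto simp: T_def)
  ultimately show ?thesis
    unfolding e_def by metis
qed

end

context adjacency
begin

lemma colourable_anticomplete_Un:
  assumes "A \<inter> B = {}" "anticomplete A B" "colourable A n" "colourable B n"
  shows "colourable (A \<union> B) n"
proof -
  obtain c where c: "\<And>v. v \<in> A \<Longrightarrow> c v < n" "\<And>u v. u \<in> A \<Longrightarrow> v \<in> A \<Longrightarrow> adj u v \<Longrightarrow> c u \<noteq> c v"
    using assms(3) unfolding colourable_def by blast
  obtain d where d: "\<And>v. v \<in> B \<Longrightarrow> d v < n" "\<And>u v. u \<in> B \<Longrightarrow> v \<in> B \<Longrightarrow> adj u v \<Longrightarrow> d u \<noteq> d v"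
    using assms(4) unfolding colourable_def by blast
  show ?thesis
    by (rule colourable_join[of A B c n d]) (use assms(1,2) c d in \<open>auto simp: anticomplete_def\<close>)
qed

text \<open>The vertices of \<open>A\<close> without a neighbour in \<open>B\<close>.\<close>

definition far :: "'a set \<Rightarrow> 'a set \<Rightarrow> 'a set" where
  "far A B = {a \<in> A. \<forall>b\<in>B. \<not> adj a b}"

lemma top_two_edges:
  assumes "top_two H P Q" "2 \<le> card Q"
  obtains a b c d where "a \<in> P" "b \<in> P" "adj a b" "c \<in> Q" "d \<in> Q" "adj c d"
proof -
  note t = assms(1)[unfolded top_two_def]
  have "\<exists>a\<in>S. \<exists>b\<in>S. a \<noteq> b" if S: "2 \<le> card S" for S :: "'a set"
  proof -
    have "finite S"
      using S by (intro card_ge_0_finite) simp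
    with S show ?thesis
      using card_le_Suc0_iff_eq[of S] by auto
  qed
  then show thesis
    using that t assms(2) by (meson cliqueD order.trans)
qed

end

section \<open>Two clusters in a graph without an induced P2 + P3\<close>

text \<open>
  In \<open>no_p2p3\<close>, \<open>a b\<close> is the edge and \<open>c d e\<close> the path. Apart from \<open>c \<noteq> e\<close>, the vertices are distinct
  because of the prescribed adjacencies.
\<close>

locale p2p3_free = adjacency adj for adj :: "'a \<Rightarrow> 'a \<Rightarrow> bool" +
  fixes V :: "'a set"
  assumes finite_V: "finite V"
    and no_p2p3: "\<lbrakk>a \<in> V; b \<in> V; c \<in> V; d \<in> V; e \<in> V; adj a b; adj c d; adj d e; c \<noteq> e; \<not> adj c e;
      \<not> adj a c; \<not> adj a d; \<not> adj a e; \<not> adj b c; \<not> adj b d; \<not> adj b e\<rbrakk> \<Longrightarrow> False"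
begin

lemma cluster_of_edge:
  assumes "a \<in> V" "b \<in> V" "adj a b" "H \<subseteq> V" "anticomplete {a} H" "anticomplete {b} H"
  shows "cluster H"
  unfolding cluster_def
proof (intro ballI impI, rule ccontr)
  fix x y z assume "x \<in> H" "y \<in> H" "z \<in> H" "adj x y" "adj y z" "x \<noteq> z" "\<not> adj x z"
  then show False
    using no_p2p3[of a b x y z] assms anticompleteD[OF assms(5)] anticompleteD[OF assms(6)]
    by (meson singletonI subsetD)
qed

end

text \<open>
  Two vertex sets seen from three further vertices: \<open>r\<close> is adjacent to \<open>p\<close> and \<open>p'\<close> and has no
  neighbours in \<open>H\<close> and \<open>H'\<close>, while \<open>p\<close> is complete to \<open>H'\<close> and without neighbours in \<open>H\<close>, and
  conversely for \<open>p'\<close>. The edges \<open>r p\<close> and \<open>r p'\<close>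
  make both sets disjoint unions of cliques.
\<close>

locale couple = p2p3_free adj V for adj :: "'a \<Rightarrow> 'a \<Rightarrow> bool" and V +
  fixes r p p' :: 'a and H H' :: "'a set" and M :: nat
  assumes in_V: "r \<in> V" "p \<in> V" "p' \<in> V" "H \<subseteq> V" "H' \<subseteq> V"
    and adj_r: "adj r p" "adj r p'"
    and anti_r: "anticomplete {r} H" "anticomplete {r} H'"
    and anti_p: "anticomplete {p} H" and adj_p: "\<And>y. y \<in> H' \<Longrightarrow> adj p y"
    and anti_p': "anticomplete {p'} H'" and adj_p': "\<And>x. x \<in> H \<Longrightarrow> adj p' x"
    and clique_H: "\<And>S. S \<subseteq> H \<Longrightarrow> clique S \<Longrightarrow> card S \<le> M"
    and clique_H': "\<And>S. S \<subseteq> H' \<Longrightarrow> clique S \<Longrightarrow> card S \<le> M"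
    and clique_HH': "\<And>S. S \<subseteq> H \<union> H' \<Longrightarrow> clique S \<Longrightarrow> card S \<le> M + 1"
begin

lemma swap: "couple adj V r p' p H' H M"
  using in_V adj_r anti_r anti_p adj_p anti_p' adj_p' clique_H clique_H' clique_HH'
  by unfold_locales (auto simp: Un_commute)

lemma disjoint: "H \<inter> H' = {}"
  using anti_p adj_p by (auto simp: anticomplete_def)

lemma finite_H: "finite H" and finite_H': "finite H'"
  using in_V finite_V finite_subset by blast+

lemma cluster_H: "cluster H"
  using cluster_of_edge[of r p H] in_V adj_r anti_r anti_p by blast

lemma cluster_H': "cluster H'"
  using cluster_of_edge[of r p' H'] in_V adj_r anti_r anti_p' by blast

text \<open>Otherwise the edge \<open>a b\<close> and the path \<open>y1 p y2\<close> are forbidden.\<close>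

lemma common_nonneighbours_adj:
  assumes "a \<in> H" "b \<in> H" "adj a b" "y1 \<in> H'" "y2 \<in> H'" "y1 \<noteq> y2"
    "\<not> adj a y1" "\<not> adj b y1" "\<not> adj a y2" "\<not> adj b y2"
  shows "adj y1 y2"
proof (rule ccontr)
  assume n: "\<not> adj y1 y2"
  show False
    using no_p2p3[of a b y1 p y2] assms n adj_p in_V adj_sym anticompleteD[OF anti_p] by blast
qed

text \<open>Otherwise the edge \<open>u w\<close> and the path \<open>p y x\<close> are forbidden.\<close>

lemma nonneighbour_spreads:
  assumes "u \<in> H" "w \<in> H" "adj u w" "y \<in> H'" "\<not> adj y u" "\<not> adj y w"
    and "x \<in> H" "\<not> adj x u" "\<not> adj x w"
  shows "\<not> adj y x"
proof
  assume a: "adj y x"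
  have "p \<noteq> x"
    using adj_r(1) anticompleteD[OF anti_r(1)] assms(7) by blast
  then show False
    using no_p2p3[of u w p y x] assms a adj_p in_V adj_sym anticompleteD[OF anti_p] by blast
qed

text \<open>
  If \<open>y\<close> missed an edge of \<open>H\<close>, it would miss all other components, hence an edge in another
  component, hence everything. So a vertex of \<open>H'\<close> that has a neighbour in \<open>H\<close> misses at most one
  vertex of every component of \<open>H\<close>.
\<close>

lemma adj_edge:
  assumes t: "top_two H P Q" "2 \<le> card Q"
    and y: "y \<in> H'" "y \<notin> far H' H" and uw: "u \<in> H" "w \<in> H" "adj u w"
  shows "adj y u \<or> adj y w"
proof (rule ccontr)
  assume "\<not> (adj y u \<or> adj y w)"
  then have n: "\<not> adj y u" "\<not> adj y w" by auto
  obtain a b c d where e: "a \<in> P" "b \<in> P" "adj a b" "c \<in> Q" "d \<in> Q" "adj c d"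
    using top_two_edges[OF t] .
  note t' = t(1)[unfolded top_two_def]
  obtain s s' where s: "s \<in> H" "s' \<in> H" "adj s s'"
    "\<not> adj s u" "\<not> adj s w" "\<not> adj s' u" "\<not> adj s' w"
  proof (cases "u \<in> P")
    case True
    then have "w \<in> P" using t' uw anticompleteD by (metis DiffI)
    then have "\<not> adj x z" if "x \<in> Q" "z \<in> {u, w}" for x z
      using that t' True anticompleteD[of Q "H - Q" x z] by blast
    then show ?thesis using that[of c d] e t' by blast
  next
    case False
    then have "w \<notin> P" using t' uw anticompleteD by (metis DiffI)
    then have "\<not> adj x z" if "x \<in> P" "z \<in> {u, w}" for x z
      using that t' False uw anticompleteD[of P "H - P" x z] by blast
    then show ?thesis using that[of a b] e t' by blast
  qed
  have ys: "\<not> adj y s" "\<not> adj y s'"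
    using nonneighbour_spreads[OF uw y(1) n] s by blast+
  have "\<not> adj y x" if x: "x \<in> H" for x
  proof (cases "adj x u \<or> adj x w")
    case False
    then show ?thesis using nonneighbour_spreads[OF uw y(1) n x] by blast
  next
    case True
    have no: "\<not> adj x v" if "v \<in> H" "\<not> adj v u" "\<not> adj v w" for v
    proof
      assume "adj x v"
      then show False
        using True that clusterD[OF cluster_H, of v x u] clusterD[OF cluster_H, of v x w] x uw adj_sym
        by blast
    qed
    show ?thesis
      using nonneighbour_spreads[OF s(1-3) y(1) ys x] no s by blast
  qed
  then show False using y unfolding far_def by blast
qed

lemma far_unique:
  assumes t: "top_two H P Q" "2 \<le> card Q" and t': "top_two H' P' Q'" "2 \<le> card Q'"
    and xy: "x \<in> H" "y \<in> H'" "adj x y" and z: "z1 \<in> far H H'" "z2 \<in> far H H'"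
  shows "z1 = z2"
proof (rule ccontr)
  assume ne: "z1 \<noteq> z2"
  interpret sw: couple adj V r p' p H' H M by (rule swap)
  obtain a b c d where "a \<in> P'" "b \<in> P'" "adj a b" "c \<in> Q'" "d \<in> Q'" "adj c d"
    using top_two_edges[OF t'] .
  then have ab: "a \<in> H'" "b \<in> H'" "adj a b"
    using t'(1)[unfolded top_two_def] by blast+
  have zz: "z1 \<in> H" "z2 \<in> H" "\<And>v. v \<in> H' \<Longrightarrow> \<not> adj v z1 \<and> \<not> adj v z2"
    using z adj_sym unfolding far_def by blast+
  then have "adj z1 z2"
    using sw.common_nonneighbours_adj[OF ab, of z1 z2] ne ab by blast
  moreover have "y \<notin> far H' H"
    using xy adj_sym unfolding far_def by blast
  ultimately show False
    using adj_edge[OF t xy(2), of z1 z2] zz xy by blast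
qed

end

section \<open>Two clusters with large components\<close>

text \<open>
  The components \<open>P\<close>, \<open>Q\<close>, \<open>P'\<close>, \<open>Q'\<close> have at most \<open>M\<close> vertices each, so \<open>big\<close> forces any two of them
  to have at least \<open>M + 6\<close> and any three of them at least \<open>2 * M + 6\<close> vertices together.
\<close>

locale big_couple = couple adj V r p p' H H' M
  for adj :: "'a \<Rightarrow> 'a \<Rightarrow> bool" and V r p p' H H' M +
  fixes P Q P' Q' :: "'a set"
  assumes top_H: "top_two H P Q" and top_H': "top_two H' P' Q'"
    and big: "card P + card Q + card P' + card Q' \<ge> 3 * M + 6"
    and linked: "\<exists>x\<in>H. \<exists>y\<in>H'. adj x y"
begin

lemma swap_big: "big_couple adj V r p' p H' H M P' Q' P Q"
proof -
  interpret sw: couple adj V r p' p H' H M by (rule swap)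
  show ?thesis
    using top_H top_H' big linked adj_sym by unfold_locales auto
qed

lemma parts: "P \<subseteq> H" "Q \<subseteq> H" "P \<inter> Q = {}" "clique P" "clique Q" "anticomplete P (H - P)"
    "anticomplete Q (H - Q)" "card Q \<le> card P"
  and parts': "P' \<subseteq> H'" "Q' \<subseteq> H'" "P' \<inter> Q' = {}" "clique P'" "clique Q'"
    "anticomplete P' (H' - P')" "anticomplete Q' (H' - Q')" "card Q' \<le> card P'"
  using top_H top_H' unfolding top_two_def by blast+

lemma sizes: "card P \<le> M" "card Q \<le> M" "card P' \<le> M" "card Q' \<le> M"
  using clique_H clique_H' parts parts' by blast+

lemma ge_2: "2 \<le> card Q" "2 \<le> card Q'"
  using sizes big by auto

lemma far_unique':
  shows "z1 \<in> far H H' \<Longrightarrow> z2 \<in> far H H' \<Longrightarrow> z1 = z2"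
    and "z1 \<in> far H' H \<Longrightarrow> z2 \<in> far H' H \<Longrightarrow> z1 = z2"
proof -
  interpret sw: couple adj V r p' p H' H M by (rule swap)
  obtain x y where "x \<in> H" "y \<in> H'" "adj x y" using linked by blast
  then show "z1 \<in> far H H' \<Longrightarrow> z2 \<in> far H H' \<Longrightarrow> z1 = z2"
    and "z1 \<in> far H' H \<Longrightarrow> z2 \<in> far H' H \<Longrightarrow> z1 = z2"
    using far_unique[OF top_H ge_2(1) top_H' ge_2(2)] sw.far_unique[OF top_H' ge_2(2) top_H ge_2(1)]
      adj_sym by blast+
qed

lemma adj_edge_H: "y \<in> H' \<Longrightarrow> y \<notin> far H' H \<Longrightarrow> u \<in> H \<Longrightarrow> w \<in> H \<Longrightarrow> adj u w \<Longrightarrow> adj y u \<or> adj y w"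
  using adj_edge[OF top_H ge_2(1)] .

lemma card_far: "card (far H' H) \<le> 1"
proof -
  have "finite (far H' H)"
    using finite_H' by (simp add: far_def)
  then show ?thesis
    using far_unique'(2) by (simp add: card_le_Suc0_iff_eq)
qed

text \<open>
  If \<open>z\<close> in \<open>A\<close> had no neighbour in \<open>H'\<close>, then the rest of \<open>A\<close> would be complete to almost all of \<open>A'\<close>,
  which gives a clique with more than \<open>M + 1\<close> vertices.
\<close>

lemma far_avoids:
  assumes "A \<subseteq> H" "A' \<subseteq> H'" "clique A" "clique A'" "card A + card A' \<ge> M + 4"
  shows "A \<inter> far H H' = {}"
proof (rule ccontr)
  assume "A \<inter> far H H' \<noteq> {}"
  then obtain z where z: "z \<in> A" "z \<in> far H H'" by blast
  have zn: "\<not> adj y z" if "y \<in> H'" for y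
    using z(2) that adj_sym unfolding far_def by blast
  have "adj x y" if "x \<in> A - {z}" "y \<in> A' - far H' H" for x y
    using adj_edge_H[of y z x] zn[of y] that z(1) assms(1,2) cliqueD[OF assms(3), of z x] adj_sym
    by blast
  moreover have "clique (A - {z})" "clique (A' - far H' H)"
    using clique_subset[OF assms(3)] clique_subset[OF assms(4)] by blast+
  ultimately have "clique ((A - {z}) \<union> (A' - far H' H))"
    by (intro clique_Un)
  then have "card ((A - {z}) \<union> (A' - far H' H)) \<le> M + 1"
    using assms(1,2) by (intro clique_HH') blast
  moreover have fin: "finite A" "finite A'"
    using assms(1,2) finite_H finite_H' finite_subset by blast+
  then have "card ((A - {z}) \<union> (A' - far H' H)) = card (A - {z}) + card (A' - far H' H)"
    using assms(1,2) disjoint by (intro card_Un_disjoint) auto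
  moreover have "card (A' - far H' H) \<ge> card A' - 1"
    using diff_card_le_card_Diff[of "far H' H" A'] card_far finite_subset[OF _ finite_H', of "far H' H"]
    by (force simp: far_def)
  moreover have "card (A - {z}) = card A - 1"
    using z(1) by simp
  ultimately show False
    using assms(5) by linarith
qed

lemma one_nonneighbour:
  assumes "A \<subseteq> H" "clique A" "y \<in> H'" "y \<notin> far H' H" "a \<in> A" "a' \<in> A" "\<not> adj a y" "\<not> adj a' y"
  shows "a = a'"
  using adj_edge_H[of y a a'] assms cliqueD[of A a a'] adj_sym by blast

lemma matchedI:
  assumes "A \<subseteq> H" "A' \<subseteq> H'" "clique A" "clique A'" "card A + card A' \<ge> M + 4"
  shows "matched (M + 1) A A'"
proof -
  interpret sw: big_couple adj V r p' p H' H M P' Q' P Q by (rule swap_big)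
  have "A \<inter> far H H' = {}" "A' \<inter> far H' H = {}"
    using far_avoids sw.far_avoids assms by (auto simp: add.commute)
  moreover have "finite A" "finite A'"
    using assms(1,2) finite_H finite_H' finite_subset by blast+
  moreover have "a = a'" if "a \<in> A" "a' \<in> A" "b \<in> A'" "\<not> adj a b" "\<not> adj a' b" for a a' b
    using one_nonneighbour[OF assms(1,3), of b] that assms(2) calculation by blast
  moreover have "b = b'" if "a \<in> A" "b \<in> A'" "b' \<in> A'" "\<not> adj a b" "\<not> adj a b'" for a b b'
    using sw.one_nonneighbour[OF assms(2,4), of a b b'] that assms(1) calculation(1) adj_sym by blast
  moreover have "card S \<le> M + 1" if "S \<subseteq> A \<union> A'" "clique S" for S
    using that assms(1,2) by (intro clique_HH') auto
  ultimately show ?thesis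
    using assms disjoint unfolding matched_def by blast
qed

text \<open>
  At least four vertices \<open>b\<close> of \<open>B'\<close> have a non-neighbour \<open>s\<close> in \<open>P\<close> and a non-neighbour \<open>t\<close> in \<open>Q\<close>.
  If \<open>x\<close> missed \<open>y\<close>, then for such \<open>b\<close> the edge \<open>x b\<close> and the path \<open>s y t\<close> would be forbidden, so that
  \<open>b\<close> misses \<open>x\<close> or \<open>y\<close> misses \<open>s\<close> or \<open>t\<close>. Because non-adjacency is a matching, each of the three
  alternatives accounts for at most one \<open>b\<close>.
\<close>

lemma small_complete:
  assumes A': "A' \<subseteq> H'" "clique A'" "card P + card A' \<ge> M + 4"
    and B': "B' \<subseteq> H'" "clique B'" "card P + card Q + card B' \<ge> 2 * M + 6"
    and AB: "anticomplete A' B'"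
    and x: "x \<in> H - (P \<union> Q)" "x \<notin> far H H'" and y: "y \<in> A'"
  shows "adj x y"
proof (rule ccontr)
  assume nxy: "\<not> adj x y"
  interpret sw: big_couple adj V r p' p H' H M P' Q' P Q by (rule swap_big)
  have mP: "matched (M + 1) P B'"
    by (rule matchedI[OF parts(1) B'(1) parts(4) B'(2)]) (use sizes B'(3) in linarith)
  have mQ: "matched (M + 1) Q B'"
    by (rule matchedI[OF parts(2) B'(1) parts(5) B'(2)]) (use sizes B'(3) in linarith)
  have fin: "finite P" "finite Q" "finite B'"
    using mP mQ unfolding matched_def by blast+
  have y': "y \<in> H'" "y \<notin> far H' H"
    using sw.far_avoids[of A' P] A' parts y by (auto simp: add.commute)
  define D where "D A = {b \<in> B'. \<exists>a\<in>A. \<not> adj a b}" for A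
  have D: "card A + card B' \<le> card (D A) + (M + 1)" if "matched (M + 1) A B'" for A
  proof -
    have m: "finite A" "A \<inter> B' = {}" "clique A"
      "\<And>S. S \<subseteq> A \<union> B' \<Longrightarrow> clique S \<Longrightarrow> card S \<le> M + 1"
      using that unfolding matched_def by blast+
    have "clique (A \<union> (B' - D A))"
      using clique_subset[OF B'(2), of "B' - D A"] by (intro clique_Un m(3)) (auto simp: D_def)
    then have "card (A \<union> (B' - D A)) \<le> M + 1"
      by (intro m(4)) blast
    moreover have "card (A \<union> (B' - D A)) = card A + card (B' - D A)"
      using m fin by (intro card_Un_disjoint) auto
    moreover have "card (B' - D A) = card B' - card (D A)"
      using fin by (intro card_Diff_subset) (auto simp: D_def)
    ultimately show ?thesis by linarith
  qed
  have "card (D P \<union> D Q) \<le> card B'"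
    using fin by (intro card_mono) (auto simp: D_def)
  moreover have "card (D P) + card (D Q) = card (D P \<union> D Q) + card (D P \<inter> D Q)"
    using fin by (intro card_Un_Int) (auto simp: D_def)
  ultimately have ge4: "4 \<le> card (D P \<inter> D Q)"
    using D[OF mP] D[OF mQ] B'(3) by linarith

  define E where "E A = {b \<in> B'. \<exists>a\<in>A. \<not> adj a b \<and> \<not> adj a y}" for A
  have E: "card (E A) \<le> 1" if m: "matched (M + 1) A B'" "A \<subseteq> H" for A
  proof -
    have "b = b'" if bb: "b \<in> E A" "b' \<in> E A" for b b'
    proof -
      obtain a where a: "a \<in> A" "\<not> adj a b" "\<not> adj a y" "b \<in> B'"
        using bb(1) unfolding E_def by blast
      obtain a' where a': "a' \<in> A" "\<not> adj a' b'" "\<not> adj a' y" "b' \<in> B'"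
        using bb(2) unfolding E_def by blast
      have "a = a'"
        using one_nonneighbour[of A y a a'] m y' a a' unfolding matched_def by blast
      then show ?thesis
        using m(1) a a' unfolding matched_def by blast
    qed
    moreover have "finite (E A)"
      using fin by (simp add: E_def)
    ultimately show ?thesis
      by (simp add: card_le_Suc0_iff_eq)
  qed
  define F where "F = {b \<in> B'. \<not> adj x b}"
  have F: "card F \<le> 1"
  proof -
    have "b = b'" if "b \<in> F" "b' \<in> F" for b b'
      using that sw.one_nonneighbour[OF B'(1,2), of x b b'] x adj_sym unfolding F_def by blast
    moreover have "finite F"
      using fin by (simp add: F_def)
    ultimately show ?thesis
      by (simp add: card_le_Suc0_iff_eq)
  qed
  have "D P \<inter> D Q \<subseteq> F \<union> E P \<union> E Q"
  proof
    fix b assume b: "b \<in> D P \<inter> D Q"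
    then obtain s t where st: "b \<in> B'" "s \<in> P" "\<not> adj s b" "t \<in> Q" "\<not> adj t b"
      unfolding D_def by blast
    have n: "\<not> adj x s" "\<not> adj x t" "\<not> adj s t" "s \<noteq> t" "\<not> adj b y"
      using st x y parts anticompleteD[OF parts(6), of s x] anticompleteD[OF parts(7), of t x]
        anticompleteD[OF parts(6), of s t] anticompleteD[OF AB, of y b] by blast+
    have V: "x \<in> V" "b \<in> V" "s \<in> V" "t \<in> V" "y \<in> V"
      using in_V x st y' parts B'(1) by blast+
    show "b \<in> F \<union> E P \<union> E Q"
    proof (rule ccontr)
      assume nb: "b \<notin> F \<union> E P \<union> E Q"
      then have "adj x b" "adj s y" "adj t y"
        using st unfolding F_def E_def by blast+
      then show False
        using no_p2p3[of x b s y t] V n st nxy adj_sym by blast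
    qed
  qed
  then have "card (D P \<inter> D Q) \<le> card (F \<union> E P \<union> E Q)"
    using fin by (intro card_mono) (auto simp: F_def E_def)
  also have "\<dots> \<le> card F + card (E P) + card (E Q)"
    by (meson card_Un_le le_trans add_le_mono1)
  also have "\<dots> \<le> 3"
    using F E[OF mP parts(1)] E[OF mQ parts(2)] by linarith
  finally show False
    using ge4 by linarith
qed

text \<open>Apart from vertices in \<open>far H H'\<close>, every small component is complete to \<open>P'\<close> and forms a clique with it.\<close>

lemma colourable_rest: "colourable (H - (P \<union> Q) - far H H') (M + 1 - card P')"
proof (rule colourable_cluster)
  let ?R = "H - (P \<union> Q) - far H H'"
  show "finite ?R" using finite_H by blast
  show cl: "cluster ?R" by (rule cluster_subset[OF cluster_H]) blast
  fix x assume x: "x \<in> ?R"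
  have "adj v y" if "v \<in> ?R" "y \<in> P'" for v y
  proof (rule small_complete[of P' Q'])
    show "M + 4 \<le> card P + card P'" "2 * M + 6 \<le> card P + card Q + card Q'"
      using sizes big by linarith+
    show "anticomplete P' Q'"
      using parts' unfolding anticomplete_def by blast+
  qed (use that parts' in blast)+
  moreover have sub: "component ?R x \<subseteq> ?R" by (auto simp: component_def)
  ultimately have "clique (component ?R x \<union> P')"
    using clique_component[OF cl x] parts' by (intro clique_Un) blast+
  then have "card (component ?R x \<union> P') \<le> M + 1"
    using sub parts' by (intro clique_HH') blast
  moreover have "card (component ?R x \<union> P') = card (component ?R x) + card P'"
    using sub parts'(1) disjoint finite_H finite_H'
    by (intro card_Un_disjoint) (auto intro: finite_subset)
  ultimately show "card (component ?R x) \<le> M + 1 - card P'" by linarith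
qed

text \<open>
  The vertices in \<open>far H H'\<close> and \<open>far H' H\<close> and the at most one uncoloured vertex of \<open>Q\<close> are pairwise
  non-adjacent and share one more colour.
\<close>

lemma colourable_big: "\<exists>n. colourable (H \<union> H') n \<and> 2 * n \<le> 3 * M + 6"
proof -
  interpret sw: big_couple adj V r p' p H' H M P' Q' P Q by (rule swap_big)
  let ?m = "M + 1"
  let ?e = "?m - ?m div 2"
  let ?R = "H - (P \<union> Q) - far H H'"
  let ?R' = "H' - (P' \<union> Q') - far H' H"
  have M: "matched ?m P P'" "matched ?m P Q'" "matched ?m Q P'" "matched ?m Q Q'"
    by (rule matchedI, rule parts, rule parts', rule parts, rule parts',
        use parts(8) parts'(8) sizes big in linarith)+
  have "\<exists>T\<subseteq>Q. card T \<le> 1 \<and>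
      colourable ((P \<union> Q \<union> ?R) \<union> (P' \<union> Q' \<union> ?R') - T) (?m + ?e)"
  proof (rule colourable_couple[OF M])
    show "anticomplete P Q" "anticomplete P ?R" "anticomplete Q ?R"
      using parts unfolding anticomplete_def by blast+
    show "anticomplete P' Q'" "anticomplete P' ?R'" "anticomplete Q' ?R'"
      using parts' unfolding anticomplete_def by blast+
    show "P \<inter> Q = {}" "P' \<inter> Q' = {}" "(P \<union> Q) \<inter> ?R = {}" "(P' \<union> Q') \<inter> ?R' = {}"
      using parts parts' by auto
    show "(P \<union> Q \<union> ?R) \<inter> (P' \<union> Q' \<union> ?R') = {}"
      using parts parts' disjoint by blast
    show "colourable ?R (?m - card P')" "colourable ?R' (?m - card P)"
      using colourable_rest sw.colourable_rest by auto
    show "card Q' \<le> card P'" "2 * ?m \<le> card P + card P' + ?e"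
      using sizes parts parts' big by auto
  qed
  then obtain T where T: "T \<subseteq> Q" "card T \<le> 1"
    "colourable ((P \<union> Q \<union> ?R) \<union> (P' \<union> Q' \<union> ?R') - T) (?m + ?e)" by blast
  have avoid: "far H H' \<inter> (P \<union> Q) = {}"
    using far_avoids[of P P'] far_avoids[of Q P'] parts parts' sizes big by auto
  have "finite T"
    by (rule finite_subset[OF T(1) finite_subset[OF parts(2) finite_H]])
  then have T1: "s = t" if "s \<in> T" "t \<in> T" for s t
    using T(2) that by (simp add: card_le_Suc0_iff_eq)
  have "\<not> adj s t" if st: "s \<in> T \<union> far H H' \<union> far H' H" "t \<in> T \<union> far H H' \<union> far H' H" for s t
  proof -
    consider "s \<in> T" "t \<in> T" | "s \<in> T" "t \<in> far H H'" | "s \<in> far H H'" "t \<in> T"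
      | "s \<in> far H H'" "t \<in> far H H'" | "s \<in> far H' H" "t \<in> far H' H"
      | "s \<in> H" "t \<in> far H' H" | "s \<in> far H' H" "t \<in> H"
      using st T(1) parts(2) unfolding far_def by blast
    then show ?thesis
    proof cases
      case 1
      then show ?thesis using T1 adj_irrefl by blast
    next
      case 2
      then have "s \<in> Q" "t \<in> H - Q" using T(1) avoid by (auto simp: far_def)
      then show ?thesis using anticompleteD[OF parts(7)] by blast
    next
      case 3
      then have "t \<in> Q" "s \<in> H - Q" using T(1) avoid by (auto simp: far_def)
      then show ?thesis using anticompleteD[OF parts(7)] by blast
    next
      case 4
      then show ?thesis using far_unique'(1) adj_irrefl by blast
    next
      case 5
      then show ?thesis using far_unique'(2) adj_irrefl by blast
    next
      case 6
      then show ?thesis using adj_sym unfolding far_def by blast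
    next
      case 7
      then show ?thesis unfolding far_def by blast
    qed
  qed
  then have "colourable (T \<union> far H H' \<union> far H' H) 1"
    by (intro colourable_anticomplete_self) (auto simp: anticomplete_def)
  from colourable_Un[OF T(3) this] have "colourable (H \<union> H') (?m + ?e + 1)"
    by (rule colourable_mono) auto
  moreover have "2 * (?m + ?e + 1) \<le> 3 * M + 6" by presburger
  ultimately show ?thesis by blast
qed

end

context couple
begin

text \<open>
  The vertices in \<open>X\<close> remain uncoloured and count one half of a colour each, in view of
  \<open>colourable_half\<close>. The set \<open>X\<close> is needed only if the two largest components of \<open>H\<close> and \<open>H'\<close> have
  less than \<open>3 * M + 6\<close> vertices in total.
\<close>

theorem couple_bound:
  "\<exists>X n. X \<subseteq> H \<union> H' \<and> colourable (H \<union> H' - X) n \<and> 2 * n + card X \<le> min (4 * M) (3 * M + 6)"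
proof -
  obtain P Q where t: "top_two H P Q"
    using top_two_exists[OF finite_H cluster_H] by blast
  obtain P' Q' where t': "top_two H' P' Q'"
    using top_two_exists[OF finite_H' cluster_H'] by blast
  have sz: "card P \<le> M" "card Q \<le> card P" "card P' \<le> M" "card Q' \<le> card P'"
    using t t' clique_H[of P] clique_H'[of P'] unfolding top_two_def by auto
  consider (small) "card P + card Q + card P' + card Q' < 3 * M + 6"
    | (split) "\<not> (\<exists>x\<in>H. \<exists>y\<in>H'. adj x y)"
    | (big) "card P + card Q + card P' + card Q' \<ge> 3 * M + 6" "\<exists>x\<in>H. \<exists>y\<in>H'. adj x y"
    by linarith
  then show ?thesis
  proof cases
    case small
    obtain X where X: "X \<subseteq> H" "colourable (H - X) (card Q)" "card X = card P - card Q"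
      using top_two_trim[OF finite_H cluster_H t] by blast
    obtain X' where X': "X' \<subseteq> H'" "colourable (H' - X') (card Q')" "card X' = card P' - card Q'"
      using top_two_trim[OF finite_H' cluster_H' t'] by blast
    have "colourable (H \<union> H' - (X \<union> X')) (card Q + card Q')"
      using colourable_Un[OF X(2) X'(2)] by (rule colourable_mono) auto
    moreover have "card (X \<union> X') \<le> card X + card X'"
      by (rule card_Un_le)
    ultimately show ?thesis
      using X X' small sz by (intro exI[of _ "X \<union> X'"] exI[of _ "card Q + card Q'"]) auto
  next
    case split
    have component_le: "card (component H x) \<le> M" if "x \<in> H" for x
      using that clique_component[OF cluster_H] by (intro clique_H) (auto simp: component_def)
    have component_le': "card (component H' x) \<le> M" if "x \<in> H'" for x
      using that clique_component[OF cluster_H'] by (intro clique_H') (auto simp: component_def)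
    have "colourable (H \<union> H') M"
      using split by (intro colourable_anticomplete_Un disjoint colourable_cluster
          finite_H finite_H' cluster_H cluster_H' component_le component_le') (auto simp: anticomplete_def)
    then show ?thesis
      by (intro exI[of _ "{}"] exI[of _ M]) auto
  next
    case big
    then interpret big_couple adj V r p p' H H' M P Q P' Q'
      using t t' by unfold_locales
    obtain n where "colourable (H \<union> H') n" "2 * n \<le> 3 * M + 6"
      using colourable_big by blast
    then show ?thesis
      using big(1) sz by (intro exI[of _ "{}"] exI[of _ n]) auto
  qed
qed

end

section \<open>Layers of a maximum clique\<close>

context adjacency
begin

text \<open>
  The set \<open>A\<close> can be coloured at cost \<open>w\<close>, where a colour costs 2 and a vertex left uncoloured
  costs 1.
\<close>

definition half_cost :: "'a set \<Rightarrow> nat \<Rightarrow> bool" where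
  "half_cost A w \<longleftrightarrow> (\<exists>X n. X \<subseteq> A \<and> colourable (A - X) n \<and> 2 * n + card X \<le> w)"

lemma half_cost_colourable: "colourable A n \<Longrightarrow> 2 * n \<le> w \<Longrightarrow> half_cost A w"
  unfolding half_cost_def by (intro exI[of _ "{}"] exI[of _ n]) auto

lemma half_cost_Un:
  assumes "half_cost A w" "half_cost B z"
  shows "half_cost (A \<union> B) (w + z)"
proof -
  obtain X n where X: "X \<subseteq> A" "colourable (A - X) n" "2 * n + card X \<le> w"
    using assms(1) unfolding half_cost_def by blast
  obtain Y m where Y: "Y \<subseteq> B" "colourable (B - Y) m" "2 * m + card Y \<le> z"
    using assms(2) unfolding half_cost_def by blast
  have "colourable (A \<union> B - (X \<union> Y)) (n + m)"
    using colourable_Un[OF X(2) Y(2)] by (rule colourable_mono) auto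
  moreover have "card (X \<union> Y) \<le> card X + card Y"
    by (rule card_Un_le)
  ultimately show ?thesis
    unfolding half_cost_def using X Y by (intro exI[of _ "X \<union> Y"] exI[of _ "n + m"]) auto
qed

lemma half_cost_UN:
  assumes "finite I" "\<And>i. i \<in> I \<Longrightarrow> half_cost (A i) (w i)"
  shows "half_cost (\<Union>i\<in>I. A i) (\<Sum>i\<in>I. w i)"
  using assms
proof (induction I rule: finite_induct)
  case empty
  show ?case using half_cost_colourable[OF colourable_empty, of 0 0] by simp
next
  case (insert i I)
  then show ?case using half_cost_Un[of "A i" "w i"] by simp
qed

text \<open>The uncoloured vertices are coloured all at once, so the excess \<open>k\<close> is paid only once.\<close>

lemma half_cost_total:
  assumes "half_cost A w" "finite A" "\<And>S. S \<subseteq> A \<Longrightarrow> clique S \<Longrightarrow> card S \<le> k"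
  shows "\<exists>n. colourable A n \<and> 2 * n \<le> w + k"
proof -
  obtain X n where X: "X \<subseteq> A" "colourable (A - X) n" "2 * n + card X \<le> w"
    using assms(1) unfolding half_cost_def by blast
  have "\<exists>c. colourable X c \<and> 2 * c \<le> card X + k"
    using X(1) assms(2,3) finite_subset by (intro colourable_half) blast+
  then obtain c where c: "colourable X c" "2 * c \<le> card X + k"
    by blast
  have "colourable A (n + c)"
    using colourable_Un[OF X(2) c(1)] by (rule colourable_mono) auto
  then show ?thesis
    using X(3) c(2) by (intro exI[of _ "n + c"]) auto
qed

end

text \<open>
  The cost of \<open>n\<close> clusters with clique number at most \<open>M\<close> that are grouped into pairs, with one
  cluster left over if \<open>n\<close> is odd.
\<close>

definition layer_cost :: "nat \<Rightarrow> nat \<Rightarrow> nat" where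
  "layer_cost n M = n div 2 * min (4 * M) (3 * M + 6) + n mod 2 * (2 * M)"

text \<open>The vertices \<open>v 0\<close>, ..., \<open>v (k - 1)\<close> form a maximum clique.\<close>

locale max_clique = p2p3_free adj V for adj :: "'a \<Rightarrow> 'a \<Rightarrow> bool" and V +
  fixes v :: "nat \<Rightarrow> 'a" and k :: nat
  assumes v_in: "i < k \<Longrightarrow> v i \<in> V"
    and v_adj: "i < k \<Longrightarrow> j < k \<Longrightarrow> i \<noteq> j \<Longrightarrow> adj (v i) (v j)"
    and clique_le: "S \<subseteq> V \<Longrightarrow> clique S \<Longrightarrow> card S \<le> k"
begin

text \<open>
  Since the relation is irreflexive, \<open>v i\<close> counts as a non-neighbour of itself and lies in
  \<open>one_miss i\<close>. For \<open>i < j\<close>, the set \<open>two_miss i j\<close> consists of the vertices whose first two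
  non-neighbours in the enumeration are \<open>v i\<close> and \<open>v j\<close>.
\<close>

definition one_miss :: "nat \<Rightarrow> 'a set" where
  "one_miss i = {x \<in> V. \<forall>l<k. adj x (v l) \<longleftrightarrow> l \<noteq> i}"

definition two_miss :: "nat \<Rightarrow> nat \<Rightarrow> 'a set" where
  "two_miss i j = {x \<in> V. \<not> adj x (v i) \<and> \<not> adj x (v j) \<and> (\<forall>l<j. l \<noteq> i \<longrightarrow> adj x (v l))}"

lemma clique_extension:
  assumes "S \<subseteq> V" "clique S" "J \<subseteq> {..<k}" "\<And>x l. x \<in> S \<Longrightarrow> l \<in> J \<Longrightarrow> adj x (v l)"
  shows "card S + card J \<le> k"
proof -
  have J: "i < k" if "i \<in> J" for i using assms(3) that by blast
  have inj: "inj_on v J"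
    using v_adj J adj_irrefl by (intro inj_onI) metis
  have "clique (v ` J)"
    unfolding clique_def using v_adj J by blast
  then have "clique (S \<union> v ` J)"
    using assms(2,4) by (intro clique_Un) auto
  then have "card (S \<union> v ` J) \<le> k"
    using assms(1) v_in J by (intro clique_le) auto
  moreover have "card (S \<union> v ` J) = card S + card (v ` J)"
  proof (rule card_Un_disjoint)
    show "finite S" using assms(1) finite_V finite_subset by blast
    show "finite (v ` J)" using assms(3) finite_subset by blast
    show "S \<inter> v ` J = {}" using assms(4) adj_irrefl by auto
  qed
  ultimately show ?thesis
    using card_image[OF inj] by simp
qed

lemma vertices_covered: "V = (\<Union>i<k. one_miss i) \<union> (\<Union>j<k. \<Union>i<j. two_miss i j)"
proof (intro equalityI subsetI)
  fix x assume x: "x \<in> V"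
  have "\<exists>i<k. \<not> adj x (v i)"
  proof (rule ccontr)
    assume "\<not> (\<exists>i<k. \<not> adj x (v i))"
    then have "card {x} + card {..<k} \<le> k"
      using x by (intro clique_extension) (auto simp: clique_def)
    then show False by simp
  qed
  then obtain i where i: "i < k" "\<not> adj x (v i)" "\<And>l. l < i \<Longrightarrow> adj x (v l)"
    using exists_least_iff[of "\<lambda>i. i < k \<and> \<not> adj x (v i)"] by (metis less_trans)
  show "x \<in> (\<Union>i<k. one_miss i) \<union> (\<Union>j<k. \<Union>i<j. two_miss i j)"
  proof (cases "\<exists>j<k. j \<noteq> i \<and> \<not> adj x (v j)")
    case False
    then have "x \<in> one_miss i"
      using x i by (auto simp: one_miss_def)
    then show ?thesis using i by blast
  next
    case True
    then obtain j where j: "j < k" "j \<noteq> i" "\<not> adj x (v j)"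
      "\<And>l. l < j \<Longrightarrow> l \<noteq> i \<Longrightarrow> adj x (v l)"
      using exists_least_iff[of "\<lambda>j. j < k \<and> j \<noteq> i \<and> \<not> adj x (v j)"] by (metis less_trans)
    then have "i < j" "x \<in> two_miss i j"
      using i x by (auto simp: two_miss_def) (meson linorder_neqE_nat)
    then show ?thesis using j(1) by blast
  qed
qed (auto simp: one_miss_def two_miss_def)

lemma one_miss_colourable:
  assumes "i < k"
  shows "colourable (one_miss i) 1"
proof (rule colourable_anticomplete_self, unfold anticomplete_def, intro ballI notI)
  fix x y assume xy: "x \<in> one_miss i" "y \<in> one_miss i" "adj x y"
  then have "x \<noteq> y" using adj_irrefl by blast
  have "card {x, y} + card ({..<k} - {i}) \<le> k"
    using xy adj_sym by (intro clique_extension) (auto simp: one_miss_def clique_def)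
  then show False
    using assms \<open>x \<noteq> y\<close> by simp
qed

lemma two_miss_clique:
  assumes "i < j" "j < k" "S \<subseteq> two_miss i j" "clique S"
  shows "card S \<le> k - j + 1"
proof -
  have "card S + card ({..<j} - {i}) \<le> k"
    using assms by (intro clique_extension) (auto simp: two_miss_def)
  then show ?thesis using assms(1,2) by simp
qed

lemma two_miss_cluster:
  assumes "i < j" "j < k"
  shows "cluster (two_miss i j)"
  using assms v_in v_adj adj_sym
  by (intro cluster_of_edge[of "v i" "v j"]) (auto simp: two_miss_def anticomplete_def)

text \<open>
  A clique in the union of the two sets can be extended by all \<open>v l\<close> with \<open>l < j\<close> other than
  \<open>v i\<close> and \<open>v i'\<close>, so passing from one set to two raises the clique bound by one only.
\<close>

lemma two_miss_couple:
  assumes "i < j" "i' < j" "i \<noteq> i'" "j < k"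
  shows "couple adj V (v j) (v i) (v i') (two_miss i j) (two_miss i' j) (k - j + 1)"
proof unfold_locales
  show "v j \<in> V" "v i \<in> V" "v i' \<in> V" "two_miss i j \<subseteq> V" "two_miss i' j \<subseteq> V"
    using assms v_in by (auto simp: two_miss_def)
  show "adj (v j) (v i)" "adj (v j) (v i')"
    using assms by (auto intro: v_adj)
  show "anticomplete {v j} (two_miss i j)" "anticomplete {v j} (two_miss i' j)"
    "anticomplete {v i} (two_miss i j)" "anticomplete {v i'} (two_miss i' j)"
    using adj_sym by (auto simp: two_miss_def anticomplete_def)
  show "adj (v i) y" if "y \<in> two_miss i' j" for y
    using that assms adj_sym by (auto simp: two_miss_def)
  show "adj (v i') x" if "x \<in> two_miss i j" for x
    using that assms adj_sym by (auto simp: two_miss_def)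
  show "card S \<le> k - j + 1" if "S \<subseteq> two_miss i j" "clique S" for S
    using two_miss_clique assms that by blast
  show "card S \<le> k - j + 1" if "S \<subseteq> two_miss i' j" "clique S" for S
    using two_miss_clique assms that by blast
  show "card S \<le> k - j + 1 + 1" if S: "S \<subseteq> two_miss i j \<union> two_miss i' j" "clique S" for S
  proof -
    have "adj x (v l)" if "x \<in> S" "l \<in> {..<j} - {i, i'}" for x l
      using S(1) that by (auto simp: two_miss_def)
    moreover have "S \<subseteq> V"
      using S(1) by (auto simp: two_miss_def)
    ultimately have "card S + card ({..<j} - {i, i'}) \<le> k"
      using assms(4) by (intro clique_extension S(2)) auto
    moreover have "card ({..<j} - {i, i'}) = j - 2" "2 \<le> j"
      using assms by (auto simp: card_Diff_subset)
    ultimately show ?thesis using assms(4) by linarith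
  qed
qed

text \<open>The index \<open>i\<close> is paired with the other member of \<open>{2 * t, 2 * t + 1}\<close>.\<close>

lemma two_miss_layer:
  assumes "j < k"
  shows "half_cost (\<Union>i<j. two_miss i j) (layer_cost j (k - j + 1))"
proof -
  let ?M = "k - j + 1"
  let ?C = "\<lambda>t. two_miss (2 * t) j \<union> two_miss (2 * t + 1) j"
  have "half_cost (?C t) (min (4 * ?M) (3 * ?M + 6))" if "t \<in> {..<j div 2}" for t
  proof -
    interpret couple adj V "v j" "v (2 * t)" "v (2 * t + 1)" "two_miss (2 * t) j" "two_miss (2 * t + 1) j" ?M
      using that assms by (intro two_miss_couple) auto
    show ?thesis unfolding half_cost_def by (rule couple_bound)
  qed
  from half_cost_UN[OF finite_lessThan this]
  have pairs: "half_cost (\<Union>t<j div 2. ?C t) (j div 2 * min (4 * ?M) (3 * ?M + 6))"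
    by simp
  have pair_sub: "?C t \<subseteq> (\<Union>i<j. two_miss i j)" if "t < j div 2" for t
  proof -
    have "2 * t < j" "2 * t + 1 < j"
      using that by presburger+
    then show ?thesis by blast
  qed
  have in_pair: "two_miss i j \<subseteq> ?C (i div 2)" for i
  proof -
    have "i = 2 * (i div 2) \<or> i = 2 * (i div 2) + 1"
      by presburger
    then show ?thesis by (metis Un_upper1 Un_upper2)
  qed
  show ?thesis
  proof (cases "even j")
    case True
    then have "i div 2 < j div 2" if "i < j" for i
      using that by presburger
    then have "(\<Union>i<j. two_miss i j) = (\<Union>t<j div 2. ?C t)"
      using pair_sub in_pair by (intro equalityI) blast+
    then show ?thesis
      using pairs True by (simp add: layer_cost_def)
  next
    case False
    have "finite (two_miss (j - 1) j)"
      using finite_V by (auto simp: two_miss_def)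
    moreover have cl: "cluster (two_miss (j - 1) j)"
      using False assms by (intro two_miss_cluster) (auto simp: odd_pos)
    moreover have "card (component (two_miss (j - 1) j) x) \<le> ?M" if "x \<in> two_miss (j - 1) j" for x
    proof (rule two_miss_clique[of "j - 1" j])
      show "clique (component (two_miss (j - 1) j) x)"
        using clique_component[OF cl that] .
    qed (use False assms in \<open>auto simp: component_def odd_pos\<close>)
    ultimately have "half_cost (two_miss (j - 1) j) (2 * ?M)"
      by (intro half_cost_colourable[OF colourable_cluster]) auto
    from half_cost_Un[OF pairs this]
    have "half_cost ((\<Union>t<j div 2. ?C t) \<union> two_miss (j - 1) j) (layer_cost j ?M)"
      using False by (simp add: layer_cost_def odd_iff_mod_2_eq_one)
    moreover have "(\<Union>i<j. two_miss i j) = (\<Union>t<j div 2. ?C t) \<union> two_miss (j - 1) j"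
    proof -
      have "i = j - 1 \<or> i div 2 < j div 2" if "i < j" for i
        using False that by presburger
      moreover have "j - 1 < j"
        using False by (auto simp: odd_pos)
      ultimately show ?thesis
        using pair_sub in_pair by (intro equalityI) blast+
    qed
    ultimately show ?thesis by simp
  qed
qed

theorem colourable_total:
  "\<exists>n. colourable V n \<and> 2 * n \<le> 3 * k + (\<Sum>j<k. layer_cost j (k - j + 1))"
proof -
  have "half_cost (one_miss i) 2" if "i \<in> {..<k}" for i
    using half_cost_colourable[OF one_miss_colourable] that by simp
  from half_cost_UN[of "{..<k}" one_miss "\<lambda>_. 2", OF finite_lessThan this]
  have "half_cost (\<Union>i<k. one_miss i) (2 * k)" by (simp add: mult.commute)
  moreover have "half_cost (\<Union>j<k. \<Union>i<j. two_miss i j) (\<Sum>j<k. layer_cost j (k - j + 1))"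
    by (intro half_cost_UN two_miss_layer) auto
  ultimately have "half_cost V (2 * k + (\<Sum>j<k. layer_cost j (k - j + 1)))"
    by (subst vertices_covered) (rule half_cost_Un)
  from half_cost_total[OF this finite_V, of k] clique_le show ?thesis
    by auto
qed

end

section \<open>The numerical estimate\<close>

text \<open>
  Every layer gains one pair when \<open>k\<close> grows by 2. The minimum is estimated by \<open>3 * M + 6\<close> here; the
  loss is harmless from \<open>k = 47\<close> on, but not in the initial values \<open>k = 47\<close> and \<open>k = 48\<close>, which are
  computed exactly.
\<close>

lemma layer_cost_step:
  "(\<Sum>j<k + 2. layer_cost j (k + 2 - j + 1)) \<le>
     (\<Sum>j<k. layer_cost j (k - j + 1)) + 2 * (k + 2) + (\<Sum>j<k. 3 * (k - j + 1) + 6)"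
proof -
  have "layer_cost (j + 2) M \<le> layer_cost j M + (3 * M + 6)" for j M
    by (simp add: layer_cost_def)
  then have "(\<Sum>j<k. layer_cost (j + 2) (k - j + 1)) \<le>
      (\<Sum>j<k. layer_cost j (k - j + 1) + (3 * (k - j + 1) + 6))"
    by (intro sum_mono)
  moreover have "(\<Sum>j<k + 2. layer_cost j (k + 2 - j + 1)) =
      layer_cost 0 (k + 3) + layer_cost 1 (k + 2) + (\<Sum>j<k. layer_cost (j + 2) (k - j + 1))"
    using sum.lessThan_Suc_shift[of "\<lambda>j. layer_cost j (k + 2 - j + 1)" "Suc k"]
      sum.lessThan_Suc_shift[of "\<lambda>j. layer_cost (Suc j) (k + 2 - Suc j + 1)" k]
    by (simp del: sum.lessThan_Suc add: numeral_3_eq_3)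
  moreover have "layer_cost 0 (k + 3) = 0" "layer_cost 1 (k + 2) = 2 * (k + 2)"
    by (simp_all add: layer_cost_def)
  ultimately show ?thesis
    by (simp add: sum.distrib)
qed

lemma sum_linear: "2 * (\<Sum>j<k. 3 * (k - j + 1) + 6) = 3 * k\<^sup>2 + 21 * k" for k :: nat
proof (induction k)
  case (Suc k)
  have "(\<Sum>j<Suc k. 3 * (Suc k - j + 1) + 6) = (3 * (Suc k + 1) + 6) + (\<Sum>j<k. 3 * (k - j + 1) + 6)"
    using sum.lessThan_Suc_shift[of "\<lambda>j. 3 * (Suc k - j + 1) + 6" k]
    by (simp del: sum.lessThan_Suc)
  with Suc show ?case
    by (simp add: power2_eq_square algebra_simps)
qed simp

lemma sum_lessThan_numeral:
  "sum f {..<numeral n} = sum f {..<pred_numeral n} + f (pred_numeral n)" for f :: "nat \<Rightarrow> nat"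
  by (simp add: numeral_eq_Suc)

lemma layer_cost_sum:
  assumes "47 \<le> k"
  shows "10 * (3 * k + (\<Sum>j<k. layer_cost j (k - j + 1))) \<le> 3 * k ^ 3"
  using assms
proof (induction k rule: less_induct)
  case (less k)
  consider "k = 47" | "k = 48" | i where "k = i + 2" "47 \<le> i"
  proof -
    have "k = 47 \<or> k = 48 \<or> k = k - 2 + 2 \<and> 47 \<le> k - 2"
      using less.prems by linarith
    then show thesis using that by blast
  qed
  then show ?case
  proof cases
    case 1
    show ?thesis unfolding 1 by (simp add: layer_cost_def sum_lessThan_numeral)
  next
    case 2
    show ?thesis unfolding 2 by (simp add: layer_cost_def sum_lessThan_numeral)
  next
    case 3
    have IH: "10 * (3 * i + (\<Sum>j<i. layer_cost j (i - j + 1))) \<le> 3 * i ^ 3"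
      using less.IH 3 by simp
    have "10 * (3 * k + (\<Sum>j<k. layer_cost j (k - j + 1))) \<le>
        10 * (3 * i + (\<Sum>j<i. layer_cost j (i - j + 1))) + 10 * (2 * i + 10)
          + 5 * (2 * (\<Sum>j<i. 3 * (i - j + 1) + 6))"
      using layer_cost_step[of i] unfolding 3(1) by simp
    also have "\<dots> \<le> 3 * i ^ 3 + 10 * (2 * i + 10) + 5 * (3 * i\<^sup>2 + 21 * i)"
      unfolding sum_linear using IH by simp
    also have "\<dots> \<le> 3 * k ^ 3"
    proof -
      have "47 * i \<le> i * i" using 3(2) by simp
      then have "100 + 125 * i + 15 * (i * i) \<le> 18 * (i * i) + 36 * i + 24"
        using 3(2) by linarith
      then show ?thesis
        unfolding 3(1) by (simp add: power3_eq_cube power2_eq_square algebra_simps)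
    qed
    finally show ?thesis .
  qed
qed

section \<open>Transfer to digraphs\<close>

lemma not_induced_freeI:
  assumes "graph G" "graph H" and inj: "inj_on f (verts H)" and sub: "f ` verts H \<subseteq> verts G"
    and adj: "\<And>u v. u \<in> verts H \<Longrightarrow> v \<in> verts H \<Longrightarrow> u \<rightarrow>\<^bsub>H\<^esub> v \<longleftrightarrow> f u \<rightarrow>\<^bsub>G\<^esub> f v"
  shows "\<not> induced_free H G"
proof -
  interpret G: graph G by fact
  interpret H: graph H by fact
  \<comment> \<open>the arc of \<open>G\<close> onto which an arc of \<open>H\<close> is mapped\<close>
  define m where "m a = (SOME b. b \<in> arcs G \<and> tail G b = f (tail H a) \<and> head G b = f (head H a))" for a
  have m: "m a \<in> arcs G" "tail G (m a) = f (tail H a)" "head G (m a) = f (head H a)"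
    if "a \<in> arcs H" for a
  proof -
    have "tail H a \<rightarrow>\<^bsub>H\<^esub> head H a"
      using that by (rule H.in_arcs_imp_in_arcs_ends)
    then have "f (tail H a) \<rightarrow>\<^bsub>G\<^esub> f (head H a)"
      using adj that by simp
    then have "\<exists>b. b \<in> arcs G \<and> tail G b = f (tail H a) \<and> head G b = f (head H a)"
      by (auto simp: arcs_ends_conv)
    from someI_ex[OF this] show "m a \<in> arcs G" "tail G (m a) = f (tail H a)" "head G (m a) = f (head H a)"
      unfolding m_def by blast+
  qed
  have m_inj: "inj_on m (arcs H)"
  proof (rule inj_onI)
    fix a b assume ab: "a \<in> arcs H" "b \<in> arcs H" "m a = m b"
    then have "f (tail H a) = f (tail H b)" "f (head H a) = f (head H b)"
      using m by metis+
    then have "tail H a = tail H b" "head H a = head H b"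
      using inj_onD[OF inj] ab by simp_all
    then show "a = b"
      using H.no_multi_arcs[of a b] ab by (simp add: arc_to_ends_def)
  qed
  let ?h = "\<lparr> iso_verts = f, iso_arcs = m, iso_head = head G, iso_tail = tail G \<rparr>"
  have "H.digraph_isomorphism ?h"
    unfolding H.digraph_isomorphism_def using m m_inj inj H.wf_digraph by simp
  moreover have "G \<restriction> (f ` verts H) = app_iso ?h H"
  proof -
    have "m ` arcs H = {e \<in> arcs G. tail G e \<in> f ` verts H \<and> head G e \<in> f ` verts H}"
    proof (intro equalityI subsetI)
      fix e assume "e \<in> {e \<in> arcs G. tail G e \<in> f ` verts H \<and> head G e \<in> f ` verts H}"
      then obtain u v where e: "e \<in> arcs G" "u \<in> verts H" "v \<in> verts H" "tail G e = f u" "head G e = f v"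
        by blast
      then have "f u \<rightarrow>\<^bsub>G\<^esub> f v"
        using G.in_arcs_imp_in_arcs_ends[of e] by simp
      then have "u \<rightarrow>\<^bsub>H\<^esub> v"
        using adj e by simp
      then obtain a where a: "a \<in> arcs H" "tail H a = u" "head H a = v"
        by (auto simp: arcs_ends_conv)
      then have "m a = e"
        using G.no_multi_arcs[of "m a" e] m[OF a(1)] e by (simp add: arc_to_ends_def)
      then show "e \<in> m ` arcs H" using a(1) by blast
    qed (use m in auto)
    then show ?thesis
      by (simp add: app_iso_def induce_subgraph_def)
  qed
  ultimately have "digraph_iso H (G \<restriction> (f ` verts H))"
    unfolding digraph_iso_def by blast
  then show ?thesis
    unfolding induced_free_def using G.induced_induce[OF sub] by blast
qed

lemma p2p3_induced:
  assumes G: "graph G" and V: "{a, b, c, d, e} \<subseteq> verts G"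
    and ad: "a \<rightarrow>\<^bsub>G\<^esub> b" "c \<rightarrow>\<^bsub>G\<^esub> d" "d \<rightarrow>\<^bsub>G\<^esub> e"
    and "c \<noteq> e" "\<not> c \<rightarrow>\<^bsub>G\<^esub> e"
    and "\<not> a \<rightarrow>\<^bsub>G\<^esub> c" "\<not> a \<rightarrow>\<^bsub>G\<^esub> d" "\<not> a \<rightarrow>\<^bsub>G\<^esub> e" "\<not> b \<rightarrow>\<^bsub>G\<^esub> c" "\<not> b \<rightarrow>\<^bsub>G\<^esub> d" "\<not> b \<rightarrow>\<^bsub>G\<^esub> e"
  shows "\<not> induced_free (disjoint_union (path_graph 2) (path_graph 3)) G"
proof -
  interpret graph G by (rule G)
  let ?H = "disjoint_union (path_graph 2) (path_graph 3)"
  let ?f = "case_sum ((!) [a, b]) ((!) [c, d, e])"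
  have rev: "b \<rightarrow>\<^bsub>G\<^esub> a" "d \<rightarrow>\<^bsub>G\<^esub> c" "e \<rightarrow>\<^bsub>G\<^esub> d" "\<not> e \<rightarrow>\<^bsub>G\<^esub> c"
    "\<not> c \<rightarrow>\<^bsub>G\<^esub> a" "\<not> d \<rightarrow>\<^bsub>G\<^esub> a" "\<not> e \<rightarrow>\<^bsub>G\<^esub> a" "\<not> c \<rightarrow>\<^bsub>G\<^esub> b" "\<not> d \<rightarrow>\<^bsub>G\<^esub> b" "\<not> e \<rightarrow>\<^bsub>G\<^esub> b"
    using assms graph_symmetric by blast+
  have irr: "\<not> u \<rightarrow>\<^bsub>G\<^esub> u" for u
    using adj_not_same by blast
  have verts: "verts ?H = {Inl 0, Inl 1, Inr 0, Inr 1, Inr 2}"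
    by (auto simp: disjoint_union_def path_graph_def lessThan_Suc numeral_2_eq_2 numeral_3_eq_3)
  have ends: "arcs_ends ?H = {(Inl 0, Inl 1), (Inl 1, Inl 0), (Inr 0, Inr 1), (Inr 1, Inr 0),
      (Inr 1, Inr 2), (Inr 2, Inr 1)}"
  proof -
    have "arcs (path_graph 2) = {(0, 1), (1, 0)}"
      "arcs (path_graph 3) = {(0, 1), (1, 0), (1, 2), (2, 1)}"
      by (auto simp: path_graph_def numeral_2_eq_2 numeral_3_eq_3 less_Suc_eq)
    then show ?thesis
      by (simp add: arcs_ends_conv disjoint_union_def Plus_def image_Un)
        (simp add: path_graph_def insert_commute)
  qed
  show ?thesis
  proof (rule not_induced_freeI[OF G])
    show "graph ?H"
      by (intro graph_disjoint_union graph_path_graph)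
    show "inj_on ?f (verts ?H)"
      unfolding verts using assms(3-) rev irr by (auto simp: inj_on_def)
    show "?f ` verts ?H \<subseteq> verts G"
      unfolding verts using V by auto
    show "u \<rightarrow>\<^bsub>?H\<^esub> v \<longleftrightarrow> ?f u \<rightarrow>\<^bsub>G\<^esub> ?f v" if "u \<in> verts ?H" "v \<in> verts ?H" for u v
      using that unfolding verts ends
      by (elim insertE emptyE) (simp_all add: assms(3-) rev irr)
  qed
qed

theorem corollary1p3:
  fixes G :: "('a, 'b) pre_digraph" and k :: nat
  assumes "graph G"
    and "induced_free (disjoint_union (path_graph 2) (path_graph 3)) G"
    and "k = clique_number G"
    and "k \<ge> 47"
  shows "real (chromatic_number G) \<le> 3 / 20 * real k ^ 3"
proof -
  interpret graph G by fact
  interpret A: adjacency "\<lambda>u w. u \<rightarrow>\<^bsub>G\<^esub> w"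
  proof
    show "w \<rightarrow>\<^bsub>G\<^esub> u" if "u \<rightarrow>\<^bsub>G\<^esub> w" for u w
      using that by (rule graph_symmetric)
    show "\<not> u \<rightarrow>\<^bsub>G\<^esub> u" for u
      using adj_not_same by blast
  qed
  have clique: "is_clique G S \<longleftrightarrow> S \<subseteq> verts G \<and> A.clique S" for S
    unfolding is_clique_def A.clique_def by blast
  obtain S where S: "is_clique G S" "card S = k"
    using clique_number_attained[OF assms(1)] assms(3) by metis
  have "finite S"
    using S(1) finite_subset[OF _ finite_verts] unfolding is_clique_def by blast
  then obtain v where v: "bij_betw v {0..<k} S"
    using ex_bij_betw_nat_finite S(2) by blast
  interpret max_clique "\<lambda>u w. u \<rightarrow>\<^bsub>G\<^esub> w" "verts G" v k
  proof
    show "finite (verts G)" by simp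
    show False
      if "a \<in> verts G" "b \<in> verts G" "c \<in> verts G" "d \<in> verts G" "e \<in> verts G"
        "a \<rightarrow>\<^bsub>G\<^esub> b" "c \<rightarrow>\<^bsub>G\<^esub> d" "d \<rightarrow>\<^bsub>G\<^esub> e" "c \<noteq> e" "\<not> c \<rightarrow>\<^bsub>G\<^esub> e"
        "\<not> a \<rightarrow>\<^bsub>G\<^esub> c" "\<not> a \<rightarrow>\<^bsub>G\<^esub> d" "\<not> a \<rightarrow>\<^bsub>G\<^esub> e" "\<not> b \<rightarrow>\<^bsub>G\<^esub> c" "\<not> b \<rightarrow>\<^bsub>G\<^esub> d" "\<not> b \<rightarrow>\<^bsub>G\<^esub> e"
      for a b c d e
      using p2p3_induced[OF assms(1), of a b c d e] that assms(2) by simp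
    show "v i \<in> verts G" if "i < k" for i
      using bij_betwE[OF v] S(1) that by (auto simp: is_clique_def)
    show "v i \<rightarrow>\<^bsub>G\<^esub> v j" if "i < k" "j < k" "i \<noteq> j" for i j
    proof -
      have "v i \<in> S" "v j \<in> S"
        using bij_betwE[OF v] that by auto
      moreover have "v i \<noteq> v j"
        using inj_onD[OF bij_betw_imp_inj_on[OF v], of i j] that by auto
      ultimately show ?thesis
        using S(1) by (simp add: is_clique_def)
    qed
    show "card T \<le> k" if "T \<subseteq> verts G" "A.clique T" for T
      using is_clique_card_le_clique_number[OF assms(1), of T] clique that assms(3) by simp
  qed
  obtain n where n: "A.colourable (verts G) n" "2 * n \<le> 3 * k + (\<Sum>j<k. layer_cost j (k - j + 1))"
    using colourable_total by blast
  have "\<exists>c. proper_colouring G n c"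
    using n(1) unfolding A.colourable_def proper_colouring_def .
  then have "chromatic_number G \<le> n"
    unfolding chromatic_number_def by (rule Least_le)
  then have "20 * chromatic_number G \<le> 10 * (2 * n)"
    by simp
  also have "\<dots> \<le> 10 * (3 * k + (\<Sum>j<k. layer_cost j (k - j + 1)))"
    using n(2) by (rule mult_le_mono2)
  also have "\<dots> \<le> 3 * k ^ 3"
    by (rule layer_cost_sum[OF assms(4)])
  finally have "real (20 * chromatic_number G) \<le> real (3 * k ^ 3)"
    by (rule of_nat_mono)
  then show ?thesis by simp
qed

end
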